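(* A polynomial $\phi\in\mathbb{R}[x_1,\dots,x_4]$ admits a complex constant pivot if and only if $\operatorname{rank}(\mu_\phi)\leq55$.
   Context: A complex constant pivot for $\phi\in\mathbb{R}[x_1,\dots,x_n]$ is a nonzero constant vector $\zeta\in\mathbb{C}^n$ such that $\langle\operatorname{Hess}(\phi)\zeta,\zeta\rangle_{\mathbb{C}}=\sum_{i,j}\partial_i\partial_j\phi\,\zeta_i\zeta_j$ is constant, where $\langle-,-\rangle_{\mathbb{C}}$ is the standard complex bilinear (not Hermitian) pairing on $\mathbb{C}^n$. Put $V_{\mathbb{C}}:=\mathbb{C}^4$. For $\phi\in\mathbb{R}[x_1,\dots,x_4]$ (extended to $V_{\mathbb{C}}$) and $c\in V_{\mathbb{C}}$, regard $D_\zeta^2\phi(c)=\sum_{i,j}\partial_i\partial_j\phi(c)\zeta_i\zeta_j$ as a quadratic form in $\zeta\in V_{\mathbb{C}}$. The Hesse system of $\phi$ is $$\mathcal{H}_\phi:=\operatorname{span}_{\mathbb{C}}\{D_\zeta^2\phi(a)-D_\zeta^2\phi(b):a,b\in V_{\mathbb{C}}\}\subseteq\operatorname{Sym}^2(V_{\mathbb{C}}^* ),$$ and $\mu_\phi\colon\operatorname{Sym}^3(V_{\mathbb{C}}^* )\otimes_{\mathbb{C}}\mathcal{H}_\phi\rightarrow\operatorname{Sym}^5(V_{\mathbb{C}}^* )$ is the $\mathbb{C}$-linear multiplication map determined by $\mu_\phi(C\otimes q)=Cq$. *)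

theory Defs
  imports
    "HOL-Analysis.Finite_Cartesian_Product"
    "HOL-Library.Poly_Mapping"
    "HOL-Library.Numeral_Type"
begin

section \<open>Polynomials in finitely many variables\<close>

text \<open>A monomial in variables indexed by \<open>'n\<close> is its exponent vector, and a polynomial is a finitely
  supported family of coefficients indexed by monomials, with the ring structure of
  \<open>HOL-Library.Poly_Mapping\<close>. The constant polynomial \<open>c\<close> is \<open>Poly_Mapping.single 0 c\<close>.\<close>

type_synonym 'n monom = "'n \<Rightarrow>\<^sub>0 nat"
type_synonym ('n, 'a) mpoly = "'n monom \<Rightarrow>\<^sub>0 'a"

definition pvar :: "'n \<Rightarrow> ('n, 'a::comm_semiring_1) mpoly" where
  "pvar i = Poly_Mapping.single (Poly_Mapping.single i 1) 1"

definition peval :: "('n::finite, 'a::comm_semiring_1) mpoly \<Rightarrow> 'a ^ 'n \<Rightarrow> 'a" where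
  "peval p v = (\<Sum>m\<in>Poly_Mapping.keys p. Poly_Mapping.lookup p m * (\<Prod>i\<in>UNIV. (v $ i) ^ Poly_Mapping.lookup m i))"

text \<open>Formal partial derivative. The subtraction of exponents truncates, but only in terms whose
  coefficient is \<open>0\<close>.\<close>

definition pderiv_at :: "'n \<Rightarrow> ('n, 'a::comm_semiring_1) mpoly \<Rightarrow> ('n, 'a) mpoly" where
  "pderiv_at i p = (\<Sum>m\<in>Poly_Mapping.keys p.
     Poly_Mapping.single (m - Poly_Mapping.single i 1)
       (of_nat (Poly_Mapping.lookup m i) * Poly_Mapping.lookup p m))"

definition complexify :: "('n, real) mpoly \<Rightarrow> ('n, complex) mpoly" where
  "complexify p = Poly_Mapping.map complex_of_real p"

section \<open>Complex constant pivots\<close>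

definition complex_constant_pivot :: "('n::finite, real) mpoly \<Rightarrow> complex ^ 'n \<Rightarrow> bool" where
  "complex_constant_pivot \<phi> \<zeta> \<longleftrightarrow> \<zeta> \<noteq> 0 \<and>
     (\<exists>k. (\<Sum>i\<in>UNIV. \<Sum>j\<in>UNIV.
             pderiv_at i (pderiv_at j (complexify \<phi>)) * Poly_Mapping.single 0 (\<zeta> $ i * \<zeta> $ j))
          = Poly_Mapping.single 0 k)"

section \<open>Complex vector spaces of finitely supported families\<close>

definition cscale :: "complex \<Rightarrow> ('k \<Rightarrow>\<^sub>0 complex) \<Rightarrow> ('k \<Rightarrow>\<^sub>0 complex)" where
  "cscale c p = Poly_Mapping.map ((*) c) p"

lemma lookup_cscale [simp]: "Poly_Mapping.lookup (cscale c p) k = c * Poly_Mapping.lookup p k"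
  unfolding cscale_def by (simp add: Poly_Mapping.map.rep_eq when_def)

interpretation cpm: vector_space "cscale :: complex \<Rightarrow> ('k \<Rightarrow>\<^sub>0 complex) \<Rightarrow> ('k \<Rightarrow>\<^sub>0 complex)"
  by unfold_locales (auto intro!: poly_mapping_eqI simp: lookup_add algebra_simps)

lemma cscale_conv_mult: "cscale c (p :: ('n, complex) mpoly) = Poly_Mapping.single 0 c * p"
  unfolding cscale_def by (rule mult_map_scale_conv_mult)

text \<open>In characteristic zero, \<open>Sym\<^sup>d(V\<^sub>\<complex>\<^sup>*)\<close> is the space of homogeneous polynomials of degree \<open>d\<close>
  in the coordinates.\<close>

definition Sym_dual :: "nat \<Rightarrow> ('n::finite, complex) mpoly set" where
  "Sym_dual d = {p. \<forall>m\<in>Poly_Mapping.keys p. (\<Sum>i\<in>UNIV. Poly_Mapping.lookup m i) = d}"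

text \<open>The quadratic form \<open>\<zeta> \<mapsto> D\<^sub>\<zeta>\<^sup>2 \<phi>(c)\<close>, as a polynomial in the coordinates of \<open>\<zeta>\<close>.\<close>

definition hessian_form :: "('n::finite, real) mpoly \<Rightarrow> complex ^ 'n \<Rightarrow> ('n, complex) mpoly" where
  "hessian_form \<phi> c = (\<Sum>i\<in>UNIV. \<Sum>j\<in>UNIV.
     cscale (peval (pderiv_at i (pderiv_at j (complexify \<phi>))) c) (pvar i * pvar j))"

definition hesse_system :: "('n::finite, real) mpoly \<Rightarrow> ('n, complex) mpoly set" where
  "hesse_system \<phi> = cpm.span {hessian_form \<phi> a - hessian_form \<phi> b | a b. True}"

section \<open>Tensor products and the multiplication map\<close>

text \<open>The tensor product of two spaces of finitely supported families, on \<open>'k\<close> and \<open>'l\<close>, is realised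
  inside the finitely supported families on \<open>'k \<times> 'l\<close>, with \<open>p \<otimes> q\<close> the family of products of
  coefficients. That this is a tensor product follows from bilinearity (\<open>tensor_add_left\<close> to
  \<open>tensor_cscale_right\<close>) and linear disjointness (\<open>tensor_independent\<close>).\<close>

definition tensor :: "('k \<Rightarrow>\<^sub>0 complex) \<Rightarrow> ('l \<Rightarrow>\<^sub>0 complex) \<Rightarrow> ('k \<times> 'l \<Rightarrow>\<^sub>0 complex)" where
  "tensor p q = (\<Sum>k\<in>Poly_Mapping.keys p. \<Sum>l\<in>Poly_Mapping.keys q.
     Poly_Mapping.single (k, l) (Poly_Mapping.lookup p k * Poly_Mapping.lookup q l))"

definition tensor_space ::
    "('k \<Rightarrow>\<^sub>0 complex) set \<Rightarrow> ('l \<Rightarrow>\<^sub>0 complex) set \<Rightarrow> ('k \<times> 'l \<Rightarrow>\<^sub>0 complex) set" where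
  "tensor_space U W = cpm.span {tensor p q | p q. p \<in> U \<and> q \<in> W}"

definition mult_map :: "('n monom \<times> 'n monom \<Rightarrow>\<^sub>0 complex) \<Rightarrow> ('n, complex) mpoly" where
  "mult_map t = (\<Sum>(m, m')\<in>Poly_Mapping.keys t.
     Poly_Mapping.single (m + m') (Poly_Mapping.lookup t (m, m')))"

definition rank_on :: "('k \<Rightarrow>\<^sub>0 complex) set \<Rightarrow> (('k \<Rightarrow>\<^sub>0 complex) \<Rightarrow> ('l \<Rightarrow>\<^sub>0 complex)) \<Rightarrow> nat" where
  "rank_on U f = cpm.dim (f ` U)"

text \<open>The rank of \<open>\<mu>\<^sub>\<phi>\<close>, which is \<open>mult_map\<close> restricted to \<open>Sym\<^sup>3(V\<^sub>\<complex>\<^sup>*) \<otimes> \<H>\<^sub>\<phi>\<close>;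
  see \<open>linear_mult_map\<close> and \<open>mult_map_tensor\<close>.\<close>

definition rank_mu :: "('n::finite, real) mpoly \<Rightarrow> nat" where
  "rank_mu \<phi> = rank_on (tensor_space (Sym_dual 3) (hesse_system \<phi>)) mult_map"

lemma lookup_tensor [simp]:
  "Poly_Mapping.lookup (tensor p q) (k, l) = Poly_Mapping.lookup p k * Poly_Mapping.lookup q l"
proof -
  have "Poly_Mapping.lookup (tensor p q) (k, l) =
      (\<Sum>k'\<in>Poly_Mapping.keys p. \<Sum>l'\<in>Poly_Mapping.keys q.
         if k' = k then (if l' = l then Poly_Mapping.lookup p k * Poly_Mapping.lookup q l else 0) else 0)"
    unfolding tensor_def lookup_sum
    by (intro sum.cong refl) (auto simp: lookup_single when_def)
  also have "\<dots> = (\<Sum>k'\<in>Poly_Mapping.keys p. if k' = k then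
      (\<Sum>l'\<in>Poly_Mapping.keys q. if l' = l then Poly_Mapping.lookup p k * Poly_Mapping.lookup q l else 0) else 0)"
    by (intro sum.cong refl) auto
  also have "\<dots> = Poly_Mapping.lookup p k * Poly_Mapping.lookup q l"
    by (auto simp: sum.delta in_keys_iff)
  finally show ?thesis .
qed

lemma tensor_add_left: "tensor (p + p') q = tensor p q + tensor p' q"
  and tensor_add_right: "tensor p (q + q') = tensor p q + tensor p q'"
  and tensor_cscale_left: "tensor (cscale c p) q = cscale c (tensor p q)"
  and tensor_cscale_right: "tensor p (cscale c q) = cscale c (tensor p q)"
  by (auto intro!: poly_mapping_eqI simp: lookup_add algebra_simps)

lemma tensor_independent:
  assumes "finite B" "finite C" "cpm.independent B" "cpm.independent C"
    and zero: "(\<Sum>b\<in>B. \<Sum>c\<in>C. cscale (a b c) (tensor b c)) = 0"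
    and "b \<in> B" "c \<in> C"
  shows "a b c = 0"
proof -
  have "(\<Sum>b\<in>B. cscale (\<Sum>c\<in>C. a b c * Poly_Mapping.lookup c l) b) = 0" for l
  proof (rule poly_mapping_eqI)
    fix k
    have "Poly_Mapping.lookup (\<Sum>b\<in>B. \<Sum>c\<in>C. cscale (a b c) (tensor b c)) (k, l) = 0"
      using zero by simp
    then show "Poly_Mapping.lookup (\<Sum>b\<in>B. cscale (\<Sum>c\<in>C. a b c * Poly_Mapping.lookup c l) b) k
        = Poly_Mapping.lookup 0 k"
      by (simp add: lookup_sum sum_distrib_left mult_ac)
  qed
  then have "(\<Sum>c\<in>C. a b c * Poly_Mapping.lookup c l) = 0" for l
    using cpm.independentD[OF assms(3,1) subset_refl, where u = "\<lambda>b. \<Sum>c\<in>C. a b c * Poly_Mapping.lookup c l"]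
      \<open>b \<in> B\<close> by blast
  then have "(\<Sum>c\<in>C. cscale (a b c) c) = 0"
    by (intro poly_mapping_eqI) (simp add: lookup_sum)
  then show ?thesis
    using cpm.independentD[OF assms(4,2) subset_refl, where u = "a b"] \<open>c \<in> C\<close> by blast
qed

lemma mult_map_superset:
  assumes "finite S" "Poly_Mapping.keys t \<subseteq> S"
  shows "mult_map t = (\<Sum>(m, m')\<in>S. Poly_Mapping.single (m + m') (Poly_Mapping.lookup t (m, m')))"
  unfolding mult_map_def using assms
  by (intro sum.mono_neutral_left) (auto simp: in_keys_iff)

lemma linear_mult_map: "Vector_Spaces.linear cscale cscale mult_map"
proof unfold_locales
  fix s t :: "'n monom \<times> 'n monom \<Rightarrow>\<^sub>0 complex"
  let ?S = "Poly_Mapping.keys s \<union> Poly_Mapping.keys t"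
  have "Poly_Mapping.keys (s + t) \<subseteq> ?S"
    by (rule Poly_Mapping.keys_add)
  then show "mult_map (s + t) = mult_map s + mult_map t"
    by (simp add: mult_map_superset[of ?S] lookup_add single_add sum.distrib case_prod_unfold)
next
  fix c and t :: "'n monom \<times> 'n monom \<Rightarrow>\<^sub>0 complex"
  have "Poly_Mapping.keys (cscale c t) \<subseteq> Poly_Mapping.keys t"
    by (auto simp: in_keys_iff)
  then show "mult_map (cscale c t) = cscale c (mult_map t)"
    by (simp add: mult_map_superset[of "Poly_Mapping.keys t"] cscale_conv_mult sum_distrib_left
        mult_single case_prod_unfold)
qed

lemma mult_map_tensor: "mult_map (tensor p q) = p * q"
proof -
  have expand: "r = (\<Sum>m\<in>Poly_Mapping.keys r. Poly_Mapping.single m (Poly_Mapping.lookup r m))"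
    for r :: "('n, complex) mpoly"
    by (rule poly_mapping_eqI)
       (auto simp: lookup_sum lookup_single when_def sum.delta in_keys_iff)
  have "Poly_Mapping.keys (tensor p q) \<subseteq> Poly_Mapping.keys p \<times> Poly_Mapping.keys q"
    by (auto simp: in_keys_iff)
  then have "mult_map (tensor p q) = (\<Sum>(m, m')\<in>Poly_Mapping.keys p \<times> Poly_Mapping.keys q.
      Poly_Mapping.single m (Poly_Mapping.lookup p m) * Poly_Mapping.single m' (Poly_Mapping.lookup q m'))"
    by (simp add: mult_map_superset[of "Poly_Mapping.keys p \<times> Poly_Mapping.keys q"] mult_single)
  also have "\<dots> = p * q"
    by (subst (3) expand[of p], subst (3) expand[of q])
       (simp add: sum_product sum.cartesian_product)
  finally show ?thesis .
qed

end

theory Submission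
  imports Defs "HOL-Analysis.Determinants" "HOL-Analysis.Continuum_Not_Denumerable"
    "HOL-Computational_Algebra.Fundamental_Theorem_Algebra"
begin

text \<open>
  A vector \<open>\<zeta> \<noteq> 0\<close> is a constant pivot exactly when it is a common zero of the quadrics in the Hesse
  system \<open>\<H>\<close> (\<open>complex_constant_pivot_iff\<close>): the difference of two Hessian forms, evaluated at \<open>\<zeta>\<close>,
  is the difference of two values of the second derivative along \<open>\<zeta>\<close>, and a complex polynomial is
  constant as soon as it is constant as a function. The target of the multiplication map has
  dimension \<open>8 choose 5 = 56\<close>, so the theorem says that \<open>\<H>\<close> has a common zero in projective space
  iff the products of cubics with elements of \<open>\<H>\<close> do not span all quintics. If \<open>\<zeta>\<close> is a common zero,
  all those products vanish at \<open>\<zeta>\<close>, whereas some \<open>x\<^sub>i\<^sup>5\<close> does not.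

  For the converse let \<open>\<H>\<close> have no common zero and let \<open>I\<close> be the ideal it generates. By the
  Nullstellensatz, \<open>x\<^sub>i\<^sup>N \<in> I\<close> for all \<open>i\<close> and some \<open>N\<close> (\<open>projective_nullstellensatz\<close>). What remains is
  Macaulay's bound (\<open>macaulay_degree_bound\<close>, \<open>nilpotent_imp_all_forms\<close>): an ideal
  of \<open>R[x\<^sub>1,\<dots>,x\<^sub>n]\<close> that is generated by forms of degree \<open>e\<close> and contains powers
  of all variables contains every form of degree greater than \<open>n(e - 1)\<close>; here \<open>n = 4\<close> and \<open>e = 2\<close>. It is proved by a determinant computation in the spirit of
  the Bezoutian, which applies to any number of generators and so avoids the selection of a regular
  sequence.

  Introduce a second set of variables \<open>y\<close> and put \<open>z\<^sub>k = x\<^sub>k - y\<^sub>k\<close>. Work in \<open>R[x][y]\<close>, let \<open>A\<close> be the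
  ideal of the polynomials whose coefficients (in \<open>R[x]\<close>) lie in \<open>I\<close>, and \<open>B = A + (y\<^sub>1\<^sup>N,\<dots>,y\<^sub>n\<^sup>N)\<close>.
  Two matrices \<open>C\<close> and \<open>D\<close> satisfy \<open>C z \<equiv> D z \<equiv> - y\<^sup>N\<close> modulo \<open>A\<close>, where \<open>y\<^sup>N\<close> is the vector of the
  \<open>y\<^sub>i\<^sup>N\<close>. The matrix \<open>D\<close> is diagonal with entries \<open>(x\<^sub>i\<^sup>N - y\<^sub>i\<^sup>N) / (x\<^sub>i - y\<^sub>i)\<close>. The matrix \<open>C\<close> comes from
  writing \<open>x\<^sub>i\<^sup>N = \<Sum>\<^sub>j a\<^sub>i\<^sub>j f\<^sub>j\<close> with \<open>f\<^sub>j \<in> \<H>\<close>, so that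
  \<open>y\<^sub>i\<^sup>N = \<Sum>\<^sub>j a\<^sub>i\<^sub>j(y) f\<^sub>j(y) \<equiv> - \<Sum>\<^sub>j a\<^sub>i\<^sub>j(y) (f\<^sub>j(x) - f\<^sub>j(y))\<close>, and expanding \<open>f\<^sub>j(x) - f\<^sub>j(y)\<close> in the
  \<open>z\<^sub>k\<close>; its entries have order at least \<open>N - e\<close> in \<open>y\<close>. Since the \<open>z\<^sub>k\<close> form a regular sequence modulo
  \<open>A\<close>, the determinants agree modulo \<open>B\<close> (\<open>det_congruent\<close>).

  Let \<open>g\<close> be a form of degree greater than \<open>n(e - 1)\<close>. Then \<open>g(y) det C\<close> has \<open>y\<close>-order greater than
  \<open>n(N - 1)\<close>, so each of its terms is divisible by some \<open>y\<^sub>i\<^sup>N\<close> and it lies in \<open>B\<close>; hence so does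
  \<open>g(y) det D\<close>. As \<open>z\<^sub>k det D \<in> B\<close>, one may replace \<open>g(y)\<close> by \<open>g(x)\<close>. The coefficient of
  \<open>(y\<^sub>1 \<cdots> y\<^sub>n)\<^sup>N\<^sup>-\<^sup>1\<close> in \<open>g(x) det D\<close> is \<open>g(x)\<close>, and therefore \<open>g \<in> I\<close>.
\<close>

section \<open>Polynomials and ideals described by coefficients\<close>

abbreviation cst :: "'a::zero \<Rightarrow> ('n, 'a) mpoly" where
  "cst \<equiv> Poly_Mapping.single 0"

abbreviation lkp :: "('k \<Rightarrow>\<^sub>0 'a::zero) \<Rightarrow> 'k \<Rightarrow> 'a" where
  "lkp \<equiv> Poly_Mapping.lookup"

text \<open>A commutative ring as a module over itself: its subspaces are the ideals, and the span of a
  set is the ideal generated by it.\<close>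

interpretation ideal: module "(*) :: 'a::comm_ring_1 \<Rightarrow> 'a \<Rightarrow> 'a"
  by unfold_locales (simp_all add: algebra_simps)

\<comment> \<open>as a rewrite rule this is associativity from right to left, which loops with \<open>mult.assoc\<close>\<close>
declare ideal.scale_scale [simp del]

lemma single_eq_0_iff: "Poly_Mapping.single k c = 0 \<longleftrightarrow> c = 0"
  by (metis lookup_single_eq lookup_zero single_zero)

lemma cst_mult: "cst a * cst b = (cst (a * b) :: ('n, 'a::comm_semiring_1) mpoly)"
  by (simp add: mult_single)

lemma cst_power: "cst a ^ j = (cst (a ^ j) :: ('n, 'a::comm_semiring_1) mpoly)"
  by (induction j) (simp_all add: cst_mult)

lemma poly_mapping_sum_single:
  "p = (\<Sum>m\<in>Poly_Mapping.keys p. Poly_Mapping.single m (lkp p m))"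
  by (rule poly_mapping_eqI)
     (auto simp: lookup_sum lookup_single when_def sum.delta in_keys_iff)

lemma poly_mapping_induct [case_names single add]:
  fixes p :: "'k \<Rightarrow>\<^sub>0 'a::comm_monoid_add"
  assumes single: "\<And>m c. P (Poly_Mapping.single m c)"
    and add: "\<And>p q. P p \<Longrightarrow> P q \<Longrightarrow> P (p + q)"
  shows "P p"
proof -
  have "P (\<Sum>m\<in>S. Poly_Mapping.single m (lkp p m))" for S
  proof (induction S rule: infinite_finite_induct)
    case (insert m S)
    then show ?case using single add by simp
  qed (use single[of undefined 0] in simp_all)
  then show ?thesis
    using poly_mapping_sum_single[of p] by metis
qed

lemma pvar_power: "pvar i ^ k = Poly_Mapping.single (Poly_Mapping.single i k) 1"
  by (induction k) (simp_all add: pvar_def mult_single single_add[symmetric])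

lemma prod_single: "(\<Prod>i\<in>S. Poly_Mapping.single (f i) (c i)) = Poly_Mapping.single (\<Sum>i\<in>S. f i) (\<Prod>i\<in>S. c i)"
  by (induction S rule: infinite_finite_induct) (simp_all add: mult_single)

lemma monom_eq_sum: "m = (\<Sum>i\<in>UNIV. Poly_Mapping.single i (lkp m i))" for m :: "'n::finite monom"
  by (rule poly_mapping_eqI) (simp add: lookup_sum lookup_single when_def)

lemma single_eq_prod_pvar:
  "Poly_Mapping.single m c = cst c * (\<Prod>i\<in>UNIV. pvar i ^ lkp m i)" for m :: "'n::finite monom"
  unfolding pvar_power prod_single using monom_eq_sum[of m] by (simp add: mult_single)

lemma mpoly_induct [case_names const var add mult]:
  fixes p :: "('n::finite, 'a::comm_semiring_1) mpoly"
  assumes const: "\<And>c. P (cst c)" and var: "\<And>i. P (pvar i)"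
    and add: "\<And>p q. P p \<Longrightarrow> P q \<Longrightarrow> P (p + q)" and mult: "\<And>p q. P p \<Longrightarrow> P q \<Longrightarrow> P (p * q)"
  shows "P p"
proof (induction p rule: poly_mapping_induct)
  case (single m c)
  have one: "P 1"
    using const[of 1] by simp
  have "P (pvar i ^ k)" for i :: 'n and k
    by (induction k) (auto intro: var mult one)
  then have "P (\<Prod>i\<in>S. pvar i ^ lkp m i)" for S
    by (induction S rule: infinite_finite_induct) (auto intro: mult one)
  then show ?case
    by (subst single_eq_prod_pvar) (intro mult const)
qed (rule add)

lemma lookup_single_mult_add:
  "lkp (Poly_Mapping.single k c * p) (k + m) = c * lkp p m"
  for p :: "('n, 'a::comm_semiring_1) mpoly"
  by (induction p rule: poly_mapping_induct)
     (auto simp: mult_single lookup_single when_def lookup_add distrib_left)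

lemma lookup_single_mult_eq_0:
  fixes p :: "('n, 'a::comm_semiring_1) mpoly"
  assumes "\<And>n. m \<noteq> k + n"
  shows "lkp (Poly_Mapping.single k c * p) m = 0"
  using assms by (induction p rule: poly_mapping_induct)
     (auto simp: mult_single lookup_single when_def lookup_add distrib_left)

lemma lookup_cst_mult [simp]: "lkp (cst c * p) m = c * lkp p m"
  for p :: "('n, 'a::comm_semiring_1) mpoly"
  using lookup_single_mult_add[of 0 c p m] by simp

text \<open>For \<open>M = UNIV\<close> this is the extension of the ideal \<open>J\<close> to the polynomial ring; for \<open>M\<close> the
  monomials with all exponents below \<open>N\<close> it is that extension plus all \<open>N\<close>-th powers of variables;
  for \<open>J = {0}\<close> and \<open>M\<close> the monomials of degree below \<open>d\<close> it is the \<open>d\<close>-th power of the ideal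
  generated by the variables. All three are ideals because \<open>M\<close> is closed under divisors.\<close>

definition coeffs_in :: "'a set \<Rightarrow> 'n monom set \<Rightarrow> ('n, 'a::zero) mpoly set" where
  "coeffs_in J M = {p. \<forall>m\<in>M. lkp p m \<in> J}"

lemma ideal_coeffs_in:
  fixes J :: "'a::comm_ring_1 set"
  assumes J: "ideal.subspace J" and M: "\<And>k m. k + m \<in> M \<Longrightarrow> m \<in> M"
  shows "ideal.subspace (coeffs_in J M)"
proof (rule ideal.subspaceI)
  show "0 \<in> coeffs_in J M"
    using ideal.subspace_0[OF J] by (simp add: coeffs_in_def)
  have sum_mem: "p + q \<in> coeffs_in J M" if "p \<in> coeffs_in J M" "q \<in> coeffs_in J M" for p q
    using that ideal.subspace_add[OF J] by (simp add: coeffs_in_def lookup_add)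
  then show "p + q \<in> coeffs_in J M" if "p \<in> coeffs_in J M" "q \<in> coeffs_in J M" for p q
    using that .
  show "c * p \<in> coeffs_in J M" if p: "p \<in> coeffs_in J M" for c p
  proof (induction c rule: poly_mapping_induct)
    case (single k c)
    show ?case
      unfolding coeffs_in_def
    proof safe
      fix m assume m: "m \<in> M"
      show "lkp (Poly_Mapping.single k c * p) m \<in> J"
      proof (cases "\<exists>n. m = k + n")
        case True
        then obtain n where n: "m = k + n" by blast
        then have "lkp p n \<in> J"
          using p m M by (auto simp: coeffs_in_def)
        then show ?thesis
          using n ideal.subspace_scale[OF J] by (simp add: lookup_single_mult_add)
      next
        case False
        then show ?thesis
          using ideal.subspace_0[OF J] by (simp add: lookup_single_mult_eq_0)
      qed
    qed
  next
    case (add c d)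
    then show ?case
      using sum_mem by (simp add: distrib_right)
  qed
qed

section \<open>Relations among the polynomials \<open>a\<^sub>k - y\<^sub>k\<close>\<close>

abbreviation free_of :: "'n \<Rightarrow> ('n, 'a::zero) mpoly \<Rightarrow> bool" where
  "free_of i p \<equiv> \<forall>m. lkp m i > 0 \<longrightarrow> lkp p m = 0"

lemma free_of_mult:
  fixes p q :: "('n, 'a::comm_ring_1) mpoly"
  assumes "free_of i p" "free_of i q"
  shows "free_of i (p * q)"
proof safe
  fix m :: "'n monom" assume "lkp m i > 0"
  moreover have "lkp m i = 0" if "m \<in> Poly_Mapping.keys (p * q)"
  proof -
    from that obtain a b where "m = a + b" "a \<in> Poly_Mapping.keys p" "b \<in> Poly_Mapping.keys q"
      using keys_mult[of p q] by blast
    then show ?thesis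
      using assms by (auto simp: lookup_add in_keys_iff)
  qed
  ultimately show "lkp (p * q) m = 0"
    by (auto simp: in_keys_iff)
qed

text \<open>Division by a polynomial that is monic up to sign in \<open>y\<^sub>i\<close>; the remainder is \<open>p\<close> with \<open>a\<close>
  substituted for \<open>y\<^sub>i\<close>.\<close>

lemma division_by_cst_minus_pvar:
  fixes p :: "('n, 'a::comm_ring_1) mpoly"
  shows "\<exists>q r. p = (cst a - pvar i) * q + r \<and> free_of i r"
proof (induction p rule: poly_mapping_induct)
  case (single m c)
  define k where "k = lkp m i"
  define n where "n = m - Poly_Mapping.single i k"
  have n: "lkp n i = 0" and m: "m = n + Poly_Mapping.single i k"
    by (auto intro!: poly_mapping_eqI simp: n_def k_def lookup_minus lookup_add lookup_single when_def)
  define u :: "('n, 'a) mpoly" where "u = - (\<Sum>l<k. cst a ^ (k - Suc l) * pvar i ^ l)"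
  have "pvar i ^ k - cst a ^ k = (pvar i - cst a) * - u"
    unfolding u_def minus_minus by (rule power_diff_sumr2)
  then have u: "pvar i ^ k = (cst a - pvar i) * u + cst a ^ k"
    by (simp add: left_diff_distrib right_diff_distrib diff_eq_eq)
  have "Poly_Mapping.single m c = Poly_Mapping.single n c * pvar i ^ k"
    by (simp add: pvar_power mult_single m)
  also have "\<dots> = (cst a - pvar i) * (Poly_Mapping.single n c * u) + Poly_Mapping.single n c * cst (a ^ k)"
    unfolding u cst_power by (simp only: distrib_left mult.left_commute)
  finally show ?case
    using n by (rule_tac exI[of _ "Poly_Mapping.single n c * u"],
        rule_tac exI[of _ "Poly_Mapping.single n c * cst (a ^ k)"])
      (auto simp: mult_single lookup_single when_def)
next
  case (add p p')
  then obtain q r q' r' where eqs: "p = (cst a - pvar i) * q + r" "p' = (cst a - pvar i) * q' + r'"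
    and free: "free_of i r" "free_of i r'" by blast
  show ?case
    unfolding eqs using free
    by (rule_tac exI[of _ "q + q'"], rule_tac exI[of _ "r + r'"]) (auto simp: lookup_add algebra_simps)
qed

text \<open>Uniqueness of quotient and remainder modulo \<open>J\<close>. Comparing coefficients at a monomial times
  \<open>y\<^sub>i\<close> expresses each coefficient of \<open>t\<close> modulo \<open>J\<close> through one of higher degree in \<open>y\<^sub>i\<close>, and the
  coefficients of high degree are zero.\<close>

lemma quotient_coeffs_in:
  fixes J :: "'a::comm_ring_1 set" and t r :: "('n::finite, 'a) mpoly"
  assumes J: "ideal.subspace J" and r: "free_of i r"
    and mem: "(cst a - pvar i) * t + r \<in> coeffs_in J UNIV"
  shows "t \<in> coeffs_in J UNIV"
proof -
  let ?e = "Poly_Mapping.single i :: nat \<Rightarrow> 'n monom"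
  have step: "lkp t m \<in> J" if "lkp t (m + ?e 1) \<in> J" for m
  proof -
    have "lkp (pvar i * t) (m + ?e 1) = lkp t m"
      using lookup_single_mult_add[of "?e 1" 1 t m] by (simp add: pvar_def add.commute)
    moreover have "lkp r (m + ?e 1) = 0"
      using r by (simp add: lookup_add)
    moreover have "lkp ((cst a - pvar i) * t + r) (m + ?e 1) \<in> J"
      using mem by (simp add: coeffs_in_def)
    ultimately have "a * lkp t (m + ?e 1) - lkp t m \<in> J"
      by (simp add: lookup_add lookup_minus left_diff_distrib)
    then show ?thesis
      using ideal.subspace_diff[OF J ideal.subspace_scale[OF J that, of a]] by fastforce
  qed
  have down: "lkp t (m + ?e k) \<in> J \<Longrightarrow> lkp t m \<in> J" for m k
  proof (induction k)
    case (Suc k)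
    have "m + ?e (Suc k) = (m + ?e k) + ?e 1"
      by (simp add: single_add[symmetric] add.assoc)
    then show ?case
      using Suc step[of "m + ?e k"] by simp
  qed simp
  have "lkp t m \<in> J" for m
  proof -
    define k where "k = Suc (\<Sum>n\<in>Poly_Mapping.keys t. lkp n i)"
    have "m + ?e k \<notin> Poly_Mapping.keys t"
    proof
      assume "m + ?e k \<in> Poly_Mapping.keys t"
      then have "lkp (m + ?e k) i \<le> (\<Sum>n\<in>Poly_Mapping.keys t. lkp n i)"
        by (intro member_le_sum) auto
      then show False
        by (simp add: lookup_add k_def)
    qed
    then show ?thesis
      using down[of m k] ideal.subspace_0[OF J] by (simp add: in_keys_iff)
  qed
  then show ?thesis
    by (simp add: coeffs_in_def)
qed

lemma ideal_coeffs_in_UNIV: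
  "ideal.subspace J \<Longrightarrow> ideal.subspace (coeffs_in J UNIV)"
  by (rule ideal_coeffs_in) auto

text \<open>Modulo the extension of \<open>J\<close>, the relations among the \<open>z\<^sub>k\<close> are generated by the Koszul relations
  \<open>z\<^sub>k z\<^sub>j - z\<^sub>j z\<^sub>k = 0\<close>. So if a family \<open>M\<close> satisfies these modulo \<open>B\<close>, that is, if it is proportional
  to \<open>z\<close>, then it satisfies every relation of \<open>z\<close>. The induction eliminates one variable: dividing the
  \<open>s k\<close> by \<open>z n\<close> splits off Koszul relations and leaves a relation among the remaining \<open>z k\<close>.\<close>

lemma syzygy_combination:
  fixes J :: "'a::comm_ring_1 set" and a :: "'n::finite \<Rightarrow> 'a"
    and s M :: "'n \<Rightarrow> ('n, 'a) mpoly" and B :: "('n, 'a) mpoly set"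
  defines "z \<equiv> \<lambda>k. cst (a k) - pvar k"
  assumes J: "ideal.subspace J" and B: "ideal.subspace B" and JB: "coeffs_in J UNIV \<subseteq> B"
    and minors: "\<And>j k. z k * M j - z j * M k \<in> B"
    and syz: "(\<Sum>k\<in>K. s k * z k) \<in> coeffs_in J UNIV"
  shows "(\<Sum>k\<in>K. s k * M k) \<in> B"
proof -
  have "finite K" by simp
  then show ?thesis
    using syz
  proof (induction K arbitrary: s rule: finite_induct)
    case empty
    then show ?case
      using ideal.subspace_0[OF B] by simp
  next
    case (insert n K)
    have "\<exists>q r. s k = z n * q + r \<and> free_of n r" for k
      unfolding z_def by (rule division_by_cst_minus_pvar)
    then obtain q r where s: "\<And>k. s k = z n * q k + r k" and r: "\<And>k. free_of n (r k)"
      by metis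
    define t where "t = s n + (\<Sum>k\<in>K. q k * z k)"
    have "free_of n (z k)" if "k \<in> K" for k
      using that insert by (auto simp: z_def pvar_def lookup_minus lookup_single when_def)
    then have free: "free_of n (\<Sum>k\<in>K. r k * z k)"
      using r by (auto simp: lookup_sum intro!: sum.neutral free_of_mult[rule_format])
    have "(\<Sum>k\<in>K. s k * z k) = z n * (\<Sum>k\<in>K. q k * z k) + (\<Sum>k\<in>K. r k * z k)"
      unfolding sum_distrib_left sum.distrib[symmetric]
      by (intro sum.cong refl) (simp only: s distrib_right mult.assoc)
    then have "(\<Sum>k\<in>insert n K. s k * z k) = z n * t + (\<Sum>k\<in>K. r k * z k)"
      using insert.hyps by (simp add: t_def distrib_left mult.commute)
    then have eq: "z n * t + (\<Sum>k\<in>K. r k * z k) \<in> coeffs_in J UNIV"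
      using insert.prems by simp
    then have t: "t \<in> coeffs_in J UNIV"
      unfolding z_def by (rule quotient_coeffs_in[OF J free[unfolded z_def]])
    then have "(\<Sum>k\<in>K. r k * z k) \<in> coeffs_in J UNIV"
      using eq ideal.subspace_diff[OF ideal_coeffs_in_UNIV[OF J] eq]
        ideal.subspace_scale[OF ideal_coeffs_in_UNIV[OF J] t, of "z n"] by fastforce
    then have IH: "(\<Sum>k\<in>K. r k * M k) \<in> B"
      by (rule insert.IH)
    have tM: "M n * t \<in> B"
      using t JB by (intro ideal.subspace_scale[OF B]) auto
    have minor_sum: "(\<Sum>k\<in>K. q k * (z n * M k - z k * M n)) \<in> B"
      using minors by (intro ideal.subspace_sum[OF B] ideal.subspace_scale[OF B])
    have "s n = t - (\<Sum>k\<in>K. q k * z k)"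
      by (simp add: t_def)
    then have "s n * M n = M n * t - (\<Sum>k\<in>K. q k * z k * M n)"
      by (simp only: left_diff_distrib sum_distrib_right mult.commute[of t])
    moreover have "(\<Sum>k\<in>K. s k * M k) = (\<Sum>k\<in>K. r k * M k) + (\<Sum>k\<in>K. q k * z n * M k)"
      unfolding sum.distrib[symmetric] by (intro sum.cong refl) (simp add: s algebra_simps)
    moreover have "(\<Sum>k\<in>K. q k * (z n * M k - z k * M n))
        = (\<Sum>k\<in>K. q k * z n * M k) - (\<Sum>k\<in>K. q k * z k * M n)"
      unfolding sum_subtractf[symmetric] by (intro sum.cong refl) (simp add: algebra_simps)
    ultimately have "(\<Sum>k\<in>insert n K. s k * M k)
        = (\<Sum>k\<in>K. r k * M k) + (M n * t + (\<Sum>k\<in>K. q k * (z n * M k - z k * M n)))"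
      using insert.hyps by simp
    then show ?case
      using IH tM minor_sum ideal.subspace_add[OF B] by simp
  qed
qed

section \<open>Determinants of congruent matrices\<close>

definition cofactor :: "'a::comm_ring_1 ^ 'n ^ 'n \<Rightarrow> 'n \<Rightarrow> 'n \<Rightarrow> 'a" where
  "cofactor P i k = det (\<chi> r c. if r = i then (if c = k then 1 else 0)
                               else if c = k then 0 else P $ r $ c)"

lemma cofactor_transpose: "cofactor (Finite_Cartesian_Product.transpose P) k i = cofactor P i k"
proof -
  have "Finite_Cartesian_Product.transpose
      (\<chi> r c. if r = i then (if c = k then 1 else 0) else if c = k then 0 else P $ r $ c)
     = (\<chi> r c. if r = k then (if c = i then 1 else 0) else if c = i then 0
              else Finite_Cartesian_Product.transpose P $ r $ c)"
    by (auto simp: Finite_Cartesian_Product.transpose_def vec_eq_iff)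
  then show ?thesis
    unfolding cofactor_def by (subst (2) det_transpose[symmetric]) simp
qed

lemma cofactor_cong: "(\<And>r. r \<noteq> i \<Longrightarrow> P $ r = Q $ r) \<Longrightarrow> cofactor P i k = cofactor Q i k"
  unfolding cofactor_def by (intro arg_cong[of _ _ det]) (auto simp: vec_eq_iff)

lemma det_expand_row: "det P = (\<Sum>k\<in>UNIV. P $ i $ k * cofactor P i k)"
  for P :: "'a::comm_ring_1 ^ 'n ^ 'n"
proof -
  let ?G = "\<lambda>k r c. if r = i then (if c = k then 1 else 0) else if c = k then 0 else P $ r $ c"
  let ?R = "UNIV - {i}"
  have split: "(\<Prod>r\<in>UNIV. h r) = h i * (\<Prod>r\<in>?R. h r)" for h :: "'n \<Rightarrow> 'a"
    by (simp add: prod.remove)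
  have expand: "(\<Sum>k\<in>UNIV. P $ i $ k * (\<Prod>r\<in>UNIV. ?G k r (p r))) = (\<Prod>r\<in>UNIV. P $ r $ p r)"
    if p: "p permutes UNIV" for p
  proof -
    have "P $ i $ k * (\<Prod>r\<in>UNIV. ?G k r (p r))
        = (if k = p i then (\<Prod>r\<in>UNIV. P $ r $ p r) else 0)" for k
    proof (cases "k = p i")
      case True
      have "(\<Prod>r\<in>?R. ?G k r (p r)) = (\<Prod>r\<in>?R. P $ r $ p r)"
        using permutes_inj[OF p] True by (intro prod.cong refl) (auto dest: injD)
      then show ?thesis
        unfolding split using True by simp
    next
      case False
      then show ?thesis
        unfolding split by simp
    qed
    then show ?thesis
      by simp
  qed
  have "(\<Sum>k\<in>UNIV. P $ i $ k * cofactor P i k)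
      = (\<Sum>p | p permutes UNIV. of_int (sign p) * (\<Sum>k\<in>UNIV. P $ i $ k * (\<Prod>r\<in>UNIV. ?G k r (p r))))"
    unfolding cofactor_def det_def
    by (simp add: sum_distrib_left mult.left_commute) (rule sum.swap)
  also have "\<dots> = det P"
    unfolding det_def by (intro sum.cong refl) (use expand in auto)
  finally show ?thesis by simp
qed

lemma column_times_cofactor:
  "(\<Sum>r\<in>UNIV. P $ r $ c * cofactor P r k) = (if c = k then det P else 0)"
  for P :: "'a::comm_ring_1 ^ 'n ^ 'n"
proof -
  define Q :: "'a ^ 'n ^ 'n" where
    "Q = (\<chi> j. if j = k then Finite_Cartesian_Product.transpose P $ c
              else Finite_Cartesian_Product.transpose P $ j)"
  have "det Q = (\<Sum>r\<in>UNIV. Q $ k $ r * cofactor Q k r)"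
    by (rule det_expand_row)
  also have "\<dots> = (\<Sum>r\<in>UNIV. P $ r $ c * cofactor P r k)"
  proof (intro sum.cong refl arg_cong2[of _ _ _ _ "(*)"])
    fix r
    have "cofactor Q k r = cofactor (Finite_Cartesian_Product.transpose P) k r"
      by (rule cofactor_cong) (simp add: Q_def)
    then show "cofactor Q k r = cofactor P r k"
      by (simp add: cofactor_transpose)
  qed (simp add: Q_def Finite_Cartesian_Product.transpose_def)
  finally have eq: "det Q = (\<Sum>r\<in>UNIV. P $ r $ c * cofactor P r k)" .
  show ?thesis
  proof (cases "c = k")
    case True
    then have "Q = Finite_Cartesian_Product.transpose P"
      by (auto simp: Q_def vec_eq_iff)
    then show ?thesis
      using eq True by simp
  next
    case False
    then have "det Q = 0"
      by (intro det_identical_rows[of k c]) (auto simp: Q_def row_def vec_eq_iff)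
    then show ?thesis
      using eq False by simp
  qed
qed

text \<open>Replacing the \<open>i\<close>-th row by the \<open>j\<close>-th unit vector gives a matrix of determinant
  \<open>cofactor P i j\<close> that sends \<open>z\<close> to \<open>z j\<close> times the \<open>i\<close>-th unit vector modulo \<open>B\<close>. The claim is Cramer's
  rule for the \<open>k\<close>-th coordinate of \<open>z\<close>; it says that the cofactors of row \<open>i\<close> are proportional to \<open>z\<close>.\<close>

lemma cofactor_proportional:
  fixes P :: "'a::comm_ring_1 ^ 'n ^ 'n"
  assumes B: "ideal.subspace B"
    and rows: "\<And>r. r \<noteq> i \<Longrightarrow> (\<Sum>c\<in>UNIV. P $ r $ c * z c) \<in> B"
  shows "z k * cofactor P i j - z j * cofactor P i k \<in> B"
proof -
  define Q :: "'a ^ 'n ^ 'n" where "Q = (\<chi> r. if r = i then axis j 1 else P $ r)"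
  have cof: "cofactor Q i l = cofactor P i l" for l
    by (rule cofactor_cong) (simp add: Q_def)
  have "det Q = (\<Sum>l\<in>UNIV. if l = j then cofactor P i l else 0)"
    unfolding det_expand_row[of Q i] cof
    by (intro sum.cong refl) (simp add: Q_def axis_def)
  then have "det Q = cofactor P i j"
    by simp
  then have "z k * cofactor P i j = (\<Sum>c\<in>UNIV. z c * (if c = k then det Q else 0))"
    by (simp add: if_distrib cong: if_cong)
  also have "\<dots> = (\<Sum>r\<in>UNIV. \<Sum>c\<in>UNIV. cofactor Q r k * (Q $ r $ c * z c))"
    unfolding column_times_cofactor[symmetric] sum_distrib_left
    by (subst sum.swap) (simp add: mult_ac)
  also have "\<dots> = (\<Sum>r\<in>UNIV. cofactor Q r k * (\<Sum>c\<in>UNIV. Q $ r $ c * z c))"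
    by (simp add: sum_distrib_left)
  also have "\<dots> = cofactor Q i k * (\<Sum>c\<in>UNIV. Q $ i $ c * z c)
      + (\<Sum>r\<in>UNIV - {i}. cofactor Q r k * (\<Sum>c\<in>UNIV. Q $ r $ c * z c))"
    by (simp add: sum.remove)
  also have "(\<Sum>c\<in>UNIV. Q $ i $ c * z c) = z j"
    by (simp add: Q_def axis_def if_distrib[of "\<lambda>x. x * _"] cong: if_cong)
  finally have "z k * cofactor P i j - z j * cofactor P i k
      = (\<Sum>r\<in>UNIV - {i}. cofactor Q r k * (\<Sum>c\<in>UNIV. Q $ r $ c * z c))"
    by (simp add: cof mult.commute)
  also have "\<dots> \<in> B"
    by (rule ideal.subspace_sum[OF B], rule ideal.subspace_scale[OF B])
       (use rows in \<open>simp add: Q_def\<close>)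
  finally show ?thesis .
qed

text \<open>Among the matrices that annihilate \<open>z\<close> modulo \<open>B\<close>, the determinant modulo \<open>B\<close> depends only on
  the product with \<open>z\<close> modulo the extension of \<open>J\<close>. Rows are exchanged one at a time: each exchange changes
  the determinant by the combination of cofactors whose coefficients are the difference of the two rows.
  That difference is a relation of \<open>z\<close>, and the cofactors, being proportional to \<open>z\<close>, satisfy it.\<close>

lemma det_congruent:
  fixes J :: "'a::comm_ring_1 set" and a :: "'n::finite \<Rightarrow> 'a"
    and C D :: "('n, 'a) mpoly ^ 'n ^ 'n" and B :: "('n, 'a) mpoly set"
  defines "z \<equiv> \<lambda>k. cst (a k) - pvar k"
  assumes J: "ideal.subspace J" and B: "ideal.subspace B" and JB: "coeffs_in J UNIV \<subseteq> B"
    and D: "\<And>i. (\<Sum>k\<in>UNIV. D $ i $ k * z k) \<in> B"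
    and CD: "\<And>i. (\<Sum>k\<in>UNIV. (C $ i $ k - D $ i $ k) * z k) \<in> coeffs_in J UNIV"
  shows "det C - det D \<in> B"
proof -
  have C: "(\<Sum>k\<in>UNIV. C $ i $ k * z k) \<in> B" for i
  proof -
    have "(\<Sum>k\<in>UNIV. C $ i $ k * z k) = (\<Sum>k\<in>UNIV. D $ i $ k * z k) + (\<Sum>k\<in>UNIV. (C $ i $ k - D $ i $ k) * z k)"
      by (simp add: left_diff_distrib sum_subtractf)
    then show ?thesis
      using ideal.subspace_add[OF B D[of i] subsetD[OF JB CD[of i]]] by simp
  qed
  \<comment> \<open>the matrices between \<open>D\<close> and \<open>C\<close>\<close>
  define P :: "'n set \<Rightarrow> ('n, 'a) mpoly ^ 'n ^ 'n" where "P S = (\<chi> i. if i \<in> S then C $ i else D $ i)" for S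
  have "det (P S) - det D \<in> B" for S
  proof (induction S rule: infinite_finite_induct)
    case (insert i S)
    have "cofactor (P (insert i S)) i k = cofactor (P S) i k" for k
      by (rule cofactor_cong) (simp add: P_def)
    then have "det (P (insert i S)) - det (P S)
        = (\<Sum>k\<in>UNIV. (C $ i $ k - D $ i $ k) * cofactor (P S) i k)"
      using insert.hyps
      by (simp add: det_expand_row[of _ i] sum_subtractf[symmetric] left_diff_distrib) (simp add: P_def)
    also have "\<dots> \<in> B"
    proof (rule syzygy_combination[OF J B JB])
      show "(\<Sum>k\<in>UNIV. (C $ i $ k - D $ i $ k) * (cst (a k) - pvar k)) \<in> coeffs_in J UNIV"
        using CD by (simp add: z_def)
      show "(cst (a k) - pvar k) * cofactor (P S) i j - (cst (a j) - pvar j) * cofactor (P S) i k \<in> B" for j k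
        by (rule cofactor_proportional[OF B]) (use C D in \<open>auto simp: P_def z_def\<close>)
    qed
    finally have "det (P (insert i S)) - det (P S) + (det (P S) - det D) \<in> B"
      using insert.IH by (rule ideal.subspace_add[OF B])
    then show ?case by simp
  qed (use ideal.subspace_0[OF B] in \<open>simp_all add: P_def\<close>)
  from this[of UNIV] show ?thesis
    by (simp add: P_def)
qed

section \<open>Macaulay's degree bound\<close>

definition mdeg :: "'n::finite monom \<Rightarrow> nat" where
  "mdeg m = (\<Sum>i\<in>UNIV. lkp m i)"

lemma mdeg_add [simp]: "mdeg (m + n) = mdeg m + mdeg n"
  by (simp add: mdeg_def lookup_add sum.distrib)

lemma mdeg_0 [simp]: "mdeg 0 = 0"
  by (simp add: mdeg_def)

lemma mdeg_single [simp]: "mdeg (Poly_Mapping.single i k) = k"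
  by (simp add: mdeg_def lookup_single when_def)

abbreviation order_ge :: "nat \<Rightarrow> ('n::finite, 'a::zero) mpoly set" where
  "order_ge d \<equiv> coeffs_in {0} {m. mdeg m < d}"

lemma order_ge_iff: "p \<in> order_ge d \<longleftrightarrow> (\<forall>m\<in>Poly_Mapping.keys p. d \<le> mdeg m)"
  using not_less by (fastforce simp: coeffs_in_def in_keys_iff)

lemma ideal_order_ge: "ideal.subspace (order_ge d :: ('n::finite, 'a::comm_ring_1) mpoly set)"
  by (rule ideal_coeffs_in) auto

lemma order_ge_mult:
  fixes p q :: "('n::finite, 'a::comm_ring_1) mpoly"
  assumes "p \<in> order_ge a" "q \<in> order_ge b"
  shows "p * q \<in> order_ge (a + b)"
  unfolding order_ge_iff
proof
  fix m assume "m \<in> Poly_Mapping.keys (p * q)"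
  then obtain k l where "m = k + l" "k \<in> Poly_Mapping.keys p" "l \<in> Poly_Mapping.keys q"
    using keys_mult[of p q] by blast
  then show "a + b \<le> mdeg m"
    using assms by (auto simp: order_ge_iff intro: add_mono)
qed

lemma order_ge_prod:
  fixes f :: "'b \<Rightarrow> ('n::finite, 'a::comm_ring_1) mpoly"
  assumes "\<And>i. i \<in> S \<Longrightarrow> f i \<in> order_ge d"
  shows "(\<Prod>i\<in>S. f i) \<in> order_ge (card S * d)"
  using assms
proof (induction S rule: infinite_finite_induct)
  case (insert i S)
  then show ?case
    using order_ge_mult[of "f i" d "prod f S" "card S * d"] by simp
qed (simp_all add: coeffs_in_def)

lemma order_ge_det:
  fixes C :: "('n::finite, 'a::comm_ring_1) mpoly ^ 'm ^ 'm"
  assumes "\<And>i k. C $ i $ k \<in> order_ge d"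
  shows "det C \<in> order_ge (CARD('m) * d)"
  unfolding det_def
  by (intro ideal.subspace_sum[OF ideal_order_ge] ideal.subspace_scale[OF ideal_order_ge]
      order_ge_prod assms)

text \<open>The polynomial \<open>p(y)\<close>, inside polynomials in \<open>y\<close> over polynomials in \<open>x\<close>; the copy \<open>p(x)\<close> is
  \<open>cst p\<close>.\<close>

definition second_copy :: "('n, 'a::zero) mpoly \<Rightarrow> ('n, ('n, 'a) mpoly) mpoly" where
  "second_copy p = Poly_Mapping.map cst p"

lemma lookup_second_copy: "lkp (second_copy p) m = cst (lkp p m)"
  unfolding second_copy_def by (simp add: Poly_Mapping.map.rep_eq when_def)

lemma second_copy_single [simp]: "second_copy (Poly_Mapping.single m c) = Poly_Mapping.single m (cst c)"
  unfolding second_copy_def by simp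

lemma second_copy_add: "second_copy (p + q) = second_copy p + second_copy q"
  for p q :: "('n, 'a::comm_ring_1) mpoly"
  by (rule poly_mapping_eqI) (simp add: lookup_second_copy lookup_add single_add)

lemma second_copy_mult: "second_copy (p * q) = second_copy p * second_copy q"
  for p q :: "('n, 'a::comm_ring_1) mpoly"
proof (induction p rule: poly_mapping_induct)
  case (single m c)
  show ?case
    by (induction q rule: poly_mapping_induct)
       (simp_all add: mult_single distrib_left second_copy_add)
qed (simp add: distrib_right second_copy_add)

lemma second_copy_pvar [simp]: "second_copy (pvar i) = pvar i"
  by (simp add: pvar_def)

lemma order_ge_second_copy:
  fixes p :: "('n::finite, 'a::zero) mpoly"
  shows "second_copy p \<in> order_ge d \<longleftrightarrow> p \<in> order_ge d"
  by (simp add: coeffs_in_def lookup_second_copy single_eq_0_iff)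

lemma sum_diagonal_mult:
  "(\<Sum>k\<in>UNIV. (if i = k then a k else 0) * b k) = a i * b i"
  for a b :: "'n::finite \<Rightarrow> 'a::comm_ring_1"
proof -
  have "(\<Sum>k\<in>UNIV. (if i = k then a k else 0) * b k) = (\<Sum>k\<in>UNIV. if i = k then a k * b k else 0)"
    by (intro sum.cong refl) simp
  then show ?thesis
    by simp
qed

abbreviation zdiff :: "'n \<Rightarrow> ('n, ('n, 'a::comm_ring_1) mpoly) mpoly" where
  "zdiff k \<equiv> cst (pvar k) - pvar k"

lemma cst_minus_second_copy:
  fixes p :: "('n::finite, 'a::comm_ring_1) mpoly"
  shows "\<exists>q. cst p - second_copy p = (\<Sum>k\<in>UNIV. q k * zdiff k)"
proof (induction p rule: mpoly_induct)
  case (const c)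
  show ?case
    by (intro exI[of _ "\<lambda>_. 0"]) simp
next
  case (var i)
  show ?case
    by (intro exI[of _ "\<lambda>k. if k = i then 1 else 0"]) (simp add: if_distrib[of "\<lambda>x. x * _"] cong: if_cong)
next
  case (add p p')
  then obtain q q' where "cst p - second_copy p = (\<Sum>k\<in>UNIV. q k * zdiff k)"
    "cst p' - second_copy p' = (\<Sum>k\<in>UNIV. q' k * zdiff k)" by blast
  then have "cst (p + p') - second_copy (p + p') = (\<Sum>k\<in>UNIV. q k * zdiff k) + (\<Sum>k\<in>UNIV. q' k * zdiff k)"
    by (simp only: second_copy_add single_add add_diff_add)
  then show ?case
    by (intro exI[of _ "\<lambda>k. q k + q' k"]) (simp only: sum.distrib distrib_right)
next
  case (mult p p')
  then obtain q q' where eqs: "cst p - second_copy p = (\<Sum>k\<in>UNIV. q k * zdiff k)"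
    "cst p' - second_copy p' = (\<Sum>k\<in>UNIV. q' k * zdiff k)" by blast
  have "cst (p * p') - second_copy (p * p')
      = cst p * (cst p' - second_copy p') + second_copy p' * (cst p - second_copy p)"
    by (simp add: second_copy_mult right_diff_distrib mult.commute[of "second_copy p'"] flip: cst_mult)
  also have "\<dots> = (\<Sum>k\<in>UNIV. (cst p * q' k + second_copy p' * q k) * zdiff k)"
    unfolding eqs by (simp only: sum_distrib_left distrib_right sum.distrib mult.assoc)
  finally show ?case
    by (intro exI[of _ "\<lambda>k. cst p * q' k + second_copy p' * q k"])
qed

text \<open>The assumption \<open>rows\<close> is what membership of the powers in an ideal generated by forms of degree
  \<open>e\<close> amounts to, with the generators eliminated. Because the powers of the variables are in \<open>I\<close>, the diagonal
  matrix \<open>D\<close> sends \<open>z\<close> to \<open>- y\<^sup>N\<close> modulo \<open>A\<close>; a matrix \<open>C\<close> of large \<open>y\<close>-order with the same property is given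
  by \<open>rows\<close>.\<close>

lemma macaulay_degree_bound:
  fixes I :: "('n::finite, 'a::comm_ring_1) mpoly set"
  assumes I: "ideal.subspace I" and e: "1 \<le> e" "e \<le> N"
    and power_in: "\<And>i. pvar i ^ N \<in> I"
    and rows: "\<And>i. \<exists>c. pvar i ^ N + (\<Sum>k\<in>UNIV. c k * zdiff k) \<in> coeffs_in I UNIV \<and> (\<forall>k. c k \<in> order_ge (N - e))"
    and g: "g \<in> order_ge (CARD('n) * (e - 1) + 1)"
  shows "g \<in> I"
proof -
  define A where "A = (coeffs_in I UNIV :: ('n, ('n, 'a) mpoly) mpoly set)"
  define B where "B = (coeffs_in I {m. \<forall>i. lkp m i < N} :: ('n, ('n, 'a) mpoly) mpoly set)"
  have A: "ideal.subspace A"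
    unfolding A_def by (rule ideal_coeffs_in_UNIV[OF I])
  have B: "ideal.subspace B"
    unfolding B_def by (rule ideal_coeffs_in[OF I]) (auto simp: lookup_add intro: le_less_trans[OF le_add2])
  have AB: "A \<subseteq> B"
    by (auto simp: A_def B_def coeffs_in_def)
  obtain c where c: "\<And>i. pvar i ^ N + (\<Sum>k\<in>UNIV. c i k * zdiff k) \<in> A"
    and ord: "\<And>i k. c i k \<in> order_ge (N - e)"
  proof -
    have "\<exists>c. \<forall>i. pvar i ^ N + (\<Sum>k\<in>UNIV. c i k * zdiff k) \<in> A \<and> (\<forall>k. c i k \<in> order_ge (N - e))"
      unfolding A_def by (intro choice allI rows)
    then show ?thesis
      using that by blast
  qed
  define C where "C = (\<chi> i k. c i k)"
  define d :: "'n \<Rightarrow> ('n, ('n, 'a) mpoly) mpoly"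
    where "d i = (\<Sum>j<N. pvar i ^ (N - Suc j) * cst (pvar i) ^ j)" for i
  define D where "D = (\<chi> i k. if i = k then d k else 0)"
  have Drow: "(\<Sum>k\<in>UNIV. D $ i $ k * zdiff k) = d i * zdiff i" for i
    by (simp add: D_def sum_diagonal_mult)
  have Dz: "(\<Sum>k\<in>UNIV. D $ i $ k * zdiff k) = cst (pvar i ^ N) - pvar i ^ N" for i
  proof -
    have "(\<Sum>k\<in>UNIV. D $ i $ k * zdiff k) = d i * zdiff i"
      by (simp add: Drow)
    also have "\<dots> = cst (pvar i) ^ N - pvar i ^ N"
      unfolding d_def power_diff_sumr2 by (rule mult.commute)
    finally show ?thesis
      by (simp add: cst_power)
  qed
  have xN: "cst (pvar i ^ N) \<in> A" for i
    using power_in[of i] ideal.subspace_0[OF I] by (auto simp: A_def coeffs_in_def lookup_single when_def)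
  have yN: "pvar i ^ N \<in> B" for i
    using ideal.subspace_0[OF I]
    by (auto simp: B_def coeffs_in_def pvar_power lookup_single when_def)
  have DB: "(\<Sum>k\<in>UNIV. D $ i $ k * zdiff k) \<in> B" for i
    unfolding Dz using ideal.subspace_diff[OF B subsetD[OF AB xN] yN] .
  \<comment> \<open>\<open>C\<close> and \<open>D\<close> both send \<open>z\<close> to \<open>- y\<^sup>N\<close> modulo \<open>A\<close>\<close>
  have "det C - det D \<in> B"
  proof (rule det_congruent[OF I B])
    show "coeffs_in I UNIV \<subseteq> B"
      using AB by (simp add: A_def)
    show "(\<Sum>k\<in>UNIV. D $ i $ k * zdiff k) \<in> B" for i
      by (rule DB)
    have "(\<Sum>k\<in>UNIV. (C $ i $ k - D $ i $ k) * zdiff k)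
        = (\<Sum>k\<in>UNIV. C $ i $ k * zdiff k) - (\<Sum>k\<in>UNIV. D $ i $ k * zdiff k)" for i
      by (simp only: left_diff_distrib sum_subtractf)
    also have "\<dots> i = (pvar i ^ N + (\<Sum>k\<in>UNIV. c i k * zdiff k)) - cst (pvar i ^ N)" for i
      unfolding Dz by (simp add: C_def)
    finally show "(\<Sum>k\<in>UNIV. (C $ i $ k - D $ i $ k) * zdiff k) \<in> coeffs_in I UNIV" for i
      using ideal.subspace_diff[OF A c xN] by (simp add: A_def)
  qed
  then have "second_copy g * (det C - det D) \<in> B"
    by (rule ideal.subspace_scale[OF B])
  moreover have "second_copy g * det C \<in> B"
  proof -
    have "second_copy g * det C \<in> order_ge ((CARD('n) * (e - 1) + 1) + CARD('n) * (N - e))"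
      by (intro order_ge_mult order_ge_det) (use g ord in \<open>auto simp: order_ge_second_copy C_def\<close>)
    also have "(CARD('n) * (e - 1) + 1) + CARD('n) * (N - e) = CARD('n) * (N - 1) + 1"
      using e by (simp flip: distrib_left)
    finally have high: "second_copy g * det C \<in> order_ge (CARD('n) * (N - 1) + 1)" .
    \<comment> \<open>too many factors for all exponents to stay below \<open>N\<close>\<close>
    have "lkp (second_copy g * det C) m = 0" if "\<forall>i. lkp m i < N" for m
    proof -
      have "mdeg m \<le> (\<Sum>i\<in>(UNIV :: 'n set). N - 1)"
        unfolding mdeg_def using that by (intro sum_mono) (metis Suc_leI diff_Suc_1 diff_le_mono)
      then show ?thesis
        using high by (simp add: coeffs_in_def less_Suc_eq_le)
    qed
    then show ?thesis
      using ideal.subspace_0[OF I] by (simp add: B_def coeffs_in_def)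
  qed
  ultimately have "second_copy g * det C - second_copy g * (det C - det D) \<in> B"
    using ideal.subspace_diff[OF B] by blast
  then have yD: "second_copy g * det D \<in> B"
    by (simp add: right_diff_distrib)
  have detD: "det D = (\<Prod>i\<in>UNIV. d i)"
    by (subst det_diagonal) (auto simp: D_def)
  have zD: "zdiff k * det D \<in> B" for k
  proof -
    have "zdiff k * det D = (\<Prod>i\<in>UNIV - {k}. d i) * (\<Sum>j\<in>UNIV. D $ k $ j * zdiff j)"
      unfolding detD Drow by (subst prod.remove[of UNIV k]) (simp_all add: mult_ac)
    then show ?thesis
      by (simp only: ideal.subspace_scale[OF B DB])
  qed
  obtain q where q: "cst g - second_copy g = (\<Sum>k\<in>UNIV. q k * zdiff k)"
    using cst_minus_second_copy by blast
  have "(cst g - second_copy g) * det D = (\<Sum>k\<in>UNIV. q k * (zdiff k * det D))"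
    unfolding q by (simp only: sum_distrib_right mult.assoc)
  also have "\<dots> \<in> B"
    by (rule ideal.subspace_sum[OF B], rule ideal.subspace_scale[OF B], rule zD)
  finally have "(cst g - second_copy g) * det D + second_copy g * det D \<in> B"
    using yD by (rule ideal.subspace_add[OF B])
  then have gD: "cst g * det D \<in> B"
    by (simp add: left_diff_distrib)
  \<comment> \<open>only the highest power of \<open>y\<^sub>i\<close> in each factor \<open>d i\<close> contributes to the coefficient at \<open>top\<close>, so it is \<open>1\<close>\<close>
  define top where "top = (\<Sum>i\<in>(UNIV :: 'n set). Poly_Mapping.single i (N - 1))"
  have lkp_exp: "lkp (\<Sum>i\<in>UNIV. Poly_Mapping.single i (f i)) j = f j" for f :: "'n \<Rightarrow> nat" and j
    by (simp add: lookup_sum lookup_single when_def)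
  have "det D = (\<Sum>h\<in>PiE UNIV (\<lambda>_. {..<N}).
      Poly_Mapping.single (\<Sum>i\<in>UNIV. Poly_Mapping.single i (N - Suc (h i))) (\<Prod>i\<in>UNIV. pvar i ^ h i))"
    unfolding detD d_def
    by (subst prod_sum_PiE) (simp_all add: cst_power pvar_power mult_single prod_single)
  also have "lkp \<dots> top = (\<Sum>h\<in>PiE (UNIV :: 'n set) (\<lambda>_. {..<N}). if h = (\<lambda>_. 0) then 1 else 0)"
    unfolding lookup_sum
  proof (rule sum.cong[OF refl])
    fix h :: "'n \<Rightarrow> nat" assume h: "h \<in> PiE UNIV (\<lambda>_. {..<N})"
    have "(\<Sum>i\<in>UNIV. Poly_Mapping.single i (N - Suc (h i))) = top \<longleftrightarrow> h = (\<lambda>_. 0)"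
    proof
      assume "(\<Sum>i\<in>UNIV. Poly_Mapping.single i (N - Suc (h i))) = top"
      then have "lkp (\<Sum>i\<in>UNIV. Poly_Mapping.single i (N - Suc (h i))) i = lkp top i" for i
        by (rule arg_cong)
      then have "N - Suc (h i) = N - 1" for i
        unfolding top_def lkp_exp .
      moreover have "h i < N" for i
        using h by auto
      ultimately have "h i = 0" for i
        using e by (metis One_nat_def Suc_inject Suc_leI diff_diff_cancel le_trans)
      then show "h = (\<lambda>_. 0)" by auto
    qed (simp add: top_def)
    then show "lkp (Poly_Mapping.single (\<Sum>i\<in>UNIV. Poly_Mapping.single i (N - Suc (h i)))
        (\<Prod>i\<in>UNIV. pvar i ^ h i)) top = (if h = (\<lambda>_. 0) then 1 else 0)"
      by (auto simp: lookup_single when_def)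
  qed
  also have "\<dots> = 1"
    using e by (subst sum.delta) (auto intro!: finite_PiE)
  finally have "lkp (cst g * det D) top = g"
    by simp
  moreover have "\<forall>i. lkp top i < N"
    using e by (simp add: top_def lkp_exp)
  ultimately show "g \<in> I"
    using gD unfolding B_def coeffs_in_def by force
qed

section \<open>Ideals generated by forms\<close>

definition hom_part :: "nat \<Rightarrow> ('n::finite, 'a::comm_monoid_add) mpoly \<Rightarrow> ('n, 'a) mpoly" where
  "hom_part d p = (\<Sum>m | m \<in> Poly_Mapping.keys p \<and> mdeg m = d. Poly_Mapping.single m (lkp p m))"

lemma lookup_hom_part: "lkp (hom_part d p) m = (if mdeg m = d then lkp p m else 0)"
  unfolding hom_part_def lookup_sum lookup_single when_def
  by (subst sum.delta) (auto simp: in_keys_iff)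

lemma hom_part_add: "hom_part d (p + q) = hom_part d p + hom_part d q"
  by (rule poly_mapping_eqI) (simp add: lookup_hom_part lookup_add)

lemma hom_part_diff: "hom_part d (p - q) = hom_part d p - hom_part d q"
  for p :: "('n::finite, 'a::ab_group_add) mpoly"
  by (rule poly_mapping_eqI) (simp add: lookup_hom_part lookup_minus)

lemma hom_part_0 [simp]: "hom_part d 0 = 0"
  by (rule poly_mapping_eqI) (simp add: lookup_hom_part)

lemma Sym_dual_iff: "p \<in> Sym_dual d \<longleftrightarrow> (\<forall>m\<in>Poly_Mapping.keys p. mdeg m = d)"
  by (simp add: Sym_dual_def mdeg_def)

lemma Sym_dual_single: "mdeg m = d \<Longrightarrow> Poly_Mapping.single m c \<in> Sym_dual d"
  by (simp add: Sym_dual_iff)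

lemma Sym_dual_mult:
  assumes "p \<in> Sym_dual a" "q \<in> Sym_dual b"
  shows "p * q \<in> Sym_dual (a + b)"
  unfolding Sym_dual_iff
proof
  fix m assume "m \<in> Poly_Mapping.keys (p * q)"
  then obtain k l where "m = k + l" "k \<in> Poly_Mapping.keys p" "l \<in> Poly_Mapping.keys q"
    using keys_mult[of p q] by blast
  then show "mdeg m = a + b"
    using assms by (auto simp: Sym_dual_iff)
qed

lemma hom_part_in_Sym_dual: "hom_part d p \<in> Sym_dual d"
  by (auto simp: Sym_dual_iff in_keys_iff lookup_hom_part split: if_splits)

lemma hom_part_Sym_dual:
  assumes "p \<in> Sym_dual k"
  shows "hom_part d p = (if d = k then p else 0)"
  using assms by (intro poly_mapping_eqI) (auto simp: Sym_dual_iff lookup_hom_part in_keys_iff)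

lemma hom_part_mult:
  assumes f: "f \<in> Sym_dual e"
  shows "hom_part d (p * f) = (if e \<le> d then hom_part (d - e) p * f else 0)"
proof (induction p rule: poly_mapping_induct)
  case (single m c)
  have m: "Poly_Mapping.single m c \<in> Sym_dual (mdeg m)"
    by (rule Sym_dual_single) simp
  show ?case
    unfolding hom_part_Sym_dual[OF m] hom_part_Sym_dual[OF Sym_dual_mult[OF m f]] by auto
qed (simp add: distrib_right hom_part_add)

text \<open>The image of the multiplication map on forms of degree \<open>k\<close> tensored with the span of \<open>H\<close>. For \<open>H\<close>
  consisting of forms of degree \<open>e\<close>, it is the part of degree \<open>k + e\<close> of the ideal generated by \<open>H\<close>.\<close>

definition products :: "nat \<Rightarrow> ('n::finite, complex) mpoly set \<Rightarrow> ('n, complex) mpoly set" where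
  "products k H = cpm.span {p * f | p f. p \<in> Sym_dual k \<and> f \<in> H}"

lemma hom_part_ideal:
  assumes H: "H \<subseteq> Sym_dual e" and p: "p \<in> ideal.span H"
  shows "hom_part d p \<in> ideal.span H" and "hom_part (k + e) p \<in> products k H"
proof -
  show "hom_part d p \<in> ideal.span H"
    using p
  proof (induction p rule: ideal.span_induct_alt)
    case (step c f q)
    have "hom_part d (c * f) \<in> ideal.span H"
      using step H ideal.span_scale[OF ideal.span_base[of f H]] ideal.span_zero[of H]
      by (auto simp: hom_part_mult[of f e])
    then show ?case
      using step by (simp add: hom_part_add ideal.span_add)
  qed (simp add: ideal.span_zero)
  show "hom_part (k + e) p \<in> products k H"
    unfolding products_def using p
  proof (induction p rule: ideal.span_induct_alt)
    case (step c f q)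
    have "hom_part (k + e) (c * f) = hom_part k c * f"
      using step H by (subst hom_part_mult[of f e]) auto
    moreover have "hom_part k c * f \<in> {p * f | p f. p \<in> Sym_dual k \<and> f \<in> H}"
      using step.hyps hom_part_in_Sym_dual by blast
    ultimately show ?case
      using step.IH by (simp add: hom_part_add cpm.span_add cpm.span_base)
  qed (simp add: cpm.span_zero)
qed

text \<open>For \<open>p = a f\<close> with \<open>f \<in> H\<close> one has \<open>p(y) = a(y) f(y) \<equiv> - a(y) (f(x) - f(y))\<close>, and the difference is a
  combination of the \<open>x\<^sub>k - y\<^sub>k\<close>; the factor \<open>a(y)\<close> provides the order in \<open>y\<close>. This yields the rows required
  by the degree bound.\<close>

lemma second_copy_products:
  fixes H :: "('n::finite, complex) mpoly set"
  assumes "p \<in> products k H"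
  shows "\<exists>c. second_copy p + (\<Sum>j\<in>UNIV. c j * zdiff j) \<in> coeffs_in (ideal.span H) UNIV
           \<and> (\<forall>j. c j \<in> order_ge k)"
  using assms unfolding products_def
proof (induction p rule: cpm.span_induct_alt)
  case base
  have "second_copy 0 = (0 :: ('n, ('n, complex) mpoly) mpoly)"
    by (simp add: second_copy_def map_eq_zero_iff)
  then show ?case
    by (intro exI[of _ "\<lambda>_. 0"]) (simp add: coeffs_in_def ideal.span_zero)
next
  case (step b x p)
  then obtain a f where x: "x = a * f" and a: "a \<in> Sym_dual k" and f: "f \<in> H" by blast
  obtain c where c: "second_copy p + (\<Sum>j\<in>UNIV. c j * zdiff j) \<in> coeffs_in (ideal.span H) UNIV"
    and ord: "\<And>j. c j \<in> order_ge k"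
    using step by blast
  obtain q where q: "cst f - second_copy f = (\<Sum>k\<in>UNIV. q k * zdiff k)"
    using cst_minus_second_copy by blast
  define s where "s = second_copy (cst b * a)"
  define c' where "c' j = s * q j + c j" for j
  have "a \<in> order_ge k"
    using a by (auto simp: Sym_dual_iff order_ge_iff)
  then have s: "s \<in> order_ge k"
    unfolding s_def order_ge_second_copy by (rule ideal.subspace_scale[OF ideal_order_ge])
  have "second_copy (cscale b x + p) + (\<Sum>j\<in>UNIV. c' j * zdiff j)
      = s * second_copy f + s * (\<Sum>k\<in>UNIV. q k * zdiff k) + (second_copy p + (\<Sum>j\<in>UNIV. c j * zdiff j))"
    by (simp add: x cscale_conv_mult s_def c'_def second_copy_add second_copy_mult distrib_right sum.distrib
        sum_distrib_left mult.assoc)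
  also have "\<dots> = s * cst f + (second_copy p + (\<Sum>j\<in>UNIV. c j * zdiff j))"
    unfolding q[symmetric] by (simp add: right_diff_distrib)
  also have "\<dots> \<in> coeffs_in (ideal.span H) UNIV"
  proof (rule ideal.subspace_add[OF _ ideal.subspace_scale c])
    show "ideal.subspace (coeffs_in (ideal.span H) UNIV :: ('n, ('n, complex) mpoly) mpoly set)"
      by (intro ideal_coeffs_in_UNIV ideal.subspace_span)
    then show "ideal.subspace (coeffs_in (ideal.span H) UNIV :: ('n, ('n, complex) mpoly) mpoly set)" .
    show "cst f \<in> coeffs_in (ideal.span H) UNIV"
      using f by (auto simp: coeffs_in_def lookup_single when_def ideal.span_base ideal.span_zero)
  qed
  finally show ?case
    using ord s by (intro exI[of _ c'])
      (auto simp: c'_def mult.commute[of s] intro!: ideal.subspace_add[OF ideal_order_ge] ideal.subspace_scale[OF ideal_order_ge])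
qed

lemma nilpotent_imp_all_forms:
  fixes H :: "('n::finite, complex) mpoly set"
  assumes H: "H \<subseteq> Sym_dual e" and e: "1 \<le> e"
    and nilpotent: "\<And>i. \<exists>N. pvar i ^ N \<in> ideal.span H"
    and g: "g \<in> Sym_dual (k + e)" and k: "CARD('n) * (e - 1) < k + e"
  shows "g \<in> products k H"
proof -
  obtain N where N: "\<And>i. pvar i ^ N i \<in> ideal.span H"
    using nilpotent by metis
  define K where "K = (\<Sum>i\<in>UNIV. N i)"
  have pow: "pvar i ^ (K + e) \<in> ideal.span H" for i
  proof -
    have "N i \<le> K + e"
      unfolding K_def by (intro trans_le_add1 member_le_sum) auto
    then have "pvar i ^ (K + e) = pvar i ^ (K + e - N i) * (pvar i ^ N i :: ('n, complex) mpoly)"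
      by (simp flip: power_add)
    then show ?thesis
      using ideal.span_scale[OF N] by metis
  qed
  have pow_Sym: "(pvar i ^ (K + e) :: ('n, complex) mpoly) \<in> Sym_dual (K + e)" for i
    unfolding pvar_power by (rule Sym_dual_single) simp
  have copy_pow: "second_copy (pvar i ^ m) = (pvar i ^ m :: ('n, ('n, complex) mpoly) mpoly)" for i m
    by (simp add: pvar_power)
  have "g \<in> ideal.span H"
  proof (rule macaulay_degree_bound[OF ideal.subspace_span e, of "K + e"])
    show "\<exists>c. pvar i ^ (K + e) + (\<Sum>k\<in>UNIV. c k * zdiff k) \<in> coeffs_in (ideal.span H) UNIV
        \<and> (\<forall>k. c k \<in> order_ge (K + e - e))" for i
      using second_copy_products[of "pvar i ^ (K + e)" K H] hom_part_ideal(2)[OF H pow, of K i]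
      by (simp add: hom_part_Sym_dual[OF pow_Sym] copy_pow)
    show "g \<in> order_ge (CARD('n) * (e - 1) + 1)"
      using g k by (auto simp: Sym_dual_iff order_ge_iff)
  qed (use pow in auto)
  from hom_part_ideal(2)[OF H this, of k] show ?thesis
    by (simp add: hom_part_Sym_dual[OF g])
qed

section \<open>Hilbert's Nullstellensatz over the complex numbers\<close>

lemma peval_superset:
  assumes "finite S" "Poly_Mapping.keys p \<subseteq> S"
  shows "peval p v = (\<Sum>m\<in>S. lkp p m * (\<Prod>i\<in>UNIV. (v $ i) ^ lkp m i))"
  unfolding peval_def using assms by (intro sum.mono_neutral_left) (auto simp: in_keys_iff)

lemma peval_add: "peval (p + q) v = peval p v + peval q v"
  using Poly_Mapping.keys_add[of p q]
  by (simp add: peval_superset[of "Poly_Mapping.keys p \<union> Poly_Mapping.keys q"] lookup_add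
      distrib_right sum.distrib)

lemma peval_single: "peval (Poly_Mapping.single m c) v = c * (\<Prod>i\<in>UNIV. (v $ i) ^ lkp m i)"
  by (subst peval_superset[of "{m}"]) auto

lemma peval_cst [simp]: "peval (cst c) v = c"
  by (simp add: peval_single)

lemma peval_pvar [simp]: "peval (pvar i) v = v $ i"
proof -
  have "(\<Prod>j\<in>UNIV. (v $ j) ^ lkp (Poly_Mapping.single i 1) j) = (\<Prod>j\<in>UNIV. if j = i then v $ j else 1)"
    by (intro prod.cong refl) (auto simp: lookup_single when_def)
  then show ?thesis
    by (simp add: pvar_def peval_single)
qed

lemma peval_mult: "peval (p * q) v = peval p v * peval q v"
proof (induction p rule: poly_mapping_induct)
  case (single m c)
  show ?case
  proof (induction q rule: poly_mapping_induct)
    case (single n d)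
    then show ?case
      by (simp add: mult_single peval_single lookup_add power_add prod.distrib mult_ac)
  qed (simp add: distrib_left peval_add)
qed (simp add: distrib_right peval_add)

lemma peval_0 [simp]: "peval 0 v = 0"
  by (simp add: peval_def)

lemma peval_diff: "peval (p - q) v = peval p v - peval q v"
  for p q :: "('n::finite, 'a::comm_ring_1) mpoly"
  using peval_add[of "p - q" q v] by (simp add: eq_diff_eq)

lemma exists_maximal_ideal:
  fixes J :: "'a::comm_ring_1 set"
  assumes J: "ideal.subspace J" "1 \<notin> J"
  obtains M where "ideal.subspace M" "J \<subseteq> M" "1 \<notin> M" "\<And>p. p \<notin> M \<Longrightarrow> \<exists>u. u * p - 1 \<in> M"
proof -
  define P where "P = {M. ideal.subspace M \<and> J \<subseteq> M \<and> 1 \<notin> M}"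
  have "\<exists>U\<in>P. \<forall>X\<in>C. X \<subseteq> U" if C: "subset.chain P C" for C
  proof (cases "C = {}")
    case True
    then show ?thesis
      using J by (auto simp: P_def)
  next
    case False
    have "ideal.subspace (\<Union>C)"
    proof (rule ideal.subspaceI)
      show "x + y \<in> \<Union>C" if xy: "x \<in> \<Union>C" "y \<in> \<Union>C" for x y
      proof -
        obtain X Y where "X \<in> C" "x \<in> X" "Y \<in> C" "y \<in> Y"
          using xy by blast
        moreover have "X \<subseteq> Y \<or> Y \<subseteq> X"
          using C calculation by (auto simp: subset_chain_def)
        ultimately have "\<exists>Z\<in>C. x \<in> Z \<and> y \<in> Z \<and> ideal.subspace Z"
          using C unfolding subset_chain_def P_def by blast
        then show ?thesis
          using ideal.subspace_add by blast
      qed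
      show "c * x \<in> \<Union>C" if "x \<in> \<Union>C" for c x
        using that C ideal.subspace_scale unfolding subset_chain_def P_def by blast
      show "0 \<in> \<Union>C"
        using False C ideal.subspace_0 unfolding subset_chain_def P_def by blast
    qed
    then have "\<Union>C \<in> P"
      using False C unfolding subset_chain_def P_def by blast
    then show ?thesis by blast
  qed
  then have "\<exists>M\<in>P. \<forall>X\<in>P. M \<subseteq> X \<longrightarrow> X = M"
    by (rule subset_Zorn)
  then obtain M where M: "M \<in> P" and max: "\<And>X. X \<in> P \<Longrightarrow> M \<subseteq> X \<Longrightarrow> X = M"
    by blast
  then have id: "ideal.subspace M" and JM: "J \<subseteq> M" and proper: "1 \<notin> M"
    by (auto simp: P_def)
  have "\<exists>u. u * p - 1 \<in> M" if "p \<notin> M" for p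
  proof -
    let ?X = "ideal.span (insert p M)"
    have "M \<subseteq> ?X" "p \<in> ?X"
      using ideal.span_superset by blast+
    then have "1 \<in> ?X"
      using max[of ?X] that JM by (auto simp: P_def)
    then obtain u where "1 - u * p \<in> ideal.span M"
      by (auto simp: ideal.span_breakdown_eq)
    then have "1 - u * p \<in> M"
      using id by (metis ideal.span_eq_iff)
    then show ?thesis
      using ideal.subspace_neg[OF id] by (metis minus_diff_eq)
  qed
  then show ?thesis
    using that id JM proper by blast
qed

lemma finite_mdeg_le: "finite {m :: 'n::finite monom. mdeg m \<le> d}"
proof (rule finite_imageD)
  have "lkp ` {m :: 'n monom. mdeg m \<le> d} \<subseteq> PiE UNIV (\<lambda>_. {..d})"
  proof safe
    fix m :: "'n monom" and i assume "mdeg m \<le> d"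
    moreover have "lkp m i \<le> mdeg m"
      unfolding mdeg_def by (rule member_le_sum) auto
    ultimately show "lkp m i \<le> d" by simp
  qed auto
  then show "finite (lkp ` {m :: 'n monom. mdeg m \<le> d})"
    by (rule finite_subset) (auto intro: finite_PiE)
  show "inj_on lkp {m :: 'n monom. mdeg m \<le> d}"
    by (auto intro: inj_onI poly_mapping_eqI)
qed

lemma in_span_monomials:
  assumes "Poly_Mapping.keys p \<subseteq> S"
  shows "p \<in> cpm.span ((\<lambda>m. Poly_Mapping.single m 1) ` S)"
proof -
  have "(\<Sum>m\<in>Poly_Mapping.keys p. cscale (lkp p m) (Poly_Mapping.single m 1)) = p"
    by (subst (3) poly_mapping_sum_single) (auto simp: cscale_def intro!: sum.cong)
  moreover have "(\<Sum>m\<in>Poly_Mapping.keys p. cscale (lkp p m) (Poly_Mapping.single m 1))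
      \<in> cpm.span ((\<lambda>m. Poly_Mapping.single m 1) ` S)"
    using assms by (intro cpm.span_sum cpm.span_scale cpm.span_base) auto
  ultimately show ?thesis by simp
qed

text \<open>The residue field of a maximal ideal \<open>M\<close> is \<open>\<complex>\<close>, and the residues of the variables are then the
  coordinates of a zero. Suppose that the residue of \<open>p\<close> is not a complex number. Then all \<open>p - c\<close> have inverses
  \<open>u c\<close> modulo \<open>M\<close>. There are uncountably many of them, while polynomials have countable dimension, so
  some are linearly dependent. Multiplying by the product of the \<open>p - c\<close> turns the dependency into a
  polynomial equation for \<open>p\<close> modulo \<open>M\<close>, which splits into linear factors, so some \<open>p - c\<close> is in \<open>M\<close>.\<close>

lemma weak_nullstellensatz:
  fixes J :: "('n::finite, complex) mpoly set"
  assumes J: "ideal.subspace J" "1 \<notin> J"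
  obtains \<zeta> where "\<And>p. p \<in> J \<Longrightarrow> peval p \<zeta> = 0"
proof -
  obtain M where M: "ideal.subspace M" and JM: "J \<subseteq> M" and proper: "1 \<notin> M"
    and inverse: "\<And>p. p \<notin> M \<Longrightarrow> \<exists>u. u * p - 1 \<in> M"
    using exists_maximal_ideal[OF J] by blast
  have cst_notin: "cst c \<notin> M" if "c \<noteq> 0" for c
  proof
    assume "cst c \<in> M"
    then have "cst (1 / c) * cst c \<in> M"
      by (rule ideal.subspace_scale[OF M])
    then show False
      using that proper by (simp add: cst_mult)
  qed
  have prime: "q \<in> M" if pq: "p * q \<in> M" and p: "p \<notin> M" for p q
  proof -
    obtain u where "u * p - 1 \<in> M"
      using inverse[OF p] by blast
    then have "u * (p * q) - q * (u * p - 1) \<in> M"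
      using ideal.subspace_diff[OF M ideal.subspace_scale[OF M pq] ideal.subspace_scale[OF M]] by blast
    then show ?thesis
      by (simp add: right_diff_distrib mult_ac)
  qed
  have residue: "\<exists>c. p - cst c \<in> M" for p
  proof (rule ccontr)
    assume "\<nexists>c. p - cst c \<in> M"
    then have notin: "p - cst c \<notin> M" for c
      by blast
    then have "\<forall>c. \<exists>u. u * (p - cst c) - 1 \<in> M"
      using inverse by blast
    then obtain u where u: "\<And>c. u c * (p - cst c) - 1 \<in> M"
      unfolding choice_iff by blast
    define F where "F h = poly (map_poly cst h) p" for h
    have F_add: "F (g + h) = F g + F h" for g h
    proof -
      have "map_poly cst (g + h) = map_poly cst g + (map_poly cst h :: ('n, complex) mpoly poly)"
        by (rule poly_eqI) (simp add: coeff_map_poly single_add)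
      then show ?thesis by (simp add: F_def)
    qed
    have F_smult: "F (smult a h) = cst a * F h" for a h
    proof -
      have "map_poly cst (smult a h) = smult (cst a) (map_poly cst h :: ('n, complex) mpoly poly)"
        by (rule poly_eqI) (simp add: coeff_map_poly cst_mult)
      then show ?thesis by (simp add: F_def)
    qed
    have F_pCons: "F (pCons a h) = cst a + p * F h" for a h
      by (simp add: F_def map_poly_pCons)
    have F_0: "F 0 = 0"
      by (simp add: F_def)
    have F_linear: "F ([:- c, 1:] * h) = (p - cst c) * F h" for c h
    proof -
      have "[:- c, 1:] * h = smult (- c) h + pCons 0 h"
        by (simp add: mult_pCons_left)
      then show ?thesis
        by (simp only: F_add F_smult F_pCons) (simp add: left_diff_distrib single_uminus)
    qed
    have F_sum: "F (\<Sum>c\<in>T. h c) = (\<Sum>c\<in>T. F (h c))" for h and T :: "complex set"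
      by (induction T rule: infinite_finite_induct) (simp_all add: F_add F_0)
    have F_prod: "F (\<Prod>c\<in>T. [:- c, 1:]) = (\<Prod>c\<in>T. p - cst c)" if "finite T" for T :: "complex set"
      using that
    proof (induction T)
      case empty
      show ?case
        by (simp add: F_def)
    next
      case (insert c T)
      show ?case
        unfolding prod.insert[OF insert.hyps] F_linear insert.IH by (rule refl)
    qed
    have F_notin: "F h \<notin> M" if "h \<noteq> 0" for h
      using that
    proof (induction "degree h" arbitrary: h)
      case 0
      then obtain a where "h = [:a:]" "a \<noteq> 0"
        by (metis degree_eq_zeroE pCons_0_0)
      then show ?case
        using cst_notin by (simp add: F_pCons F_0)
    next
      case (Suc d)
      obtain r where "poly h r = 0"
        using alg_closed_imp_poly_has_root[of h] Suc.hyps by auto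
      then obtain h' where h: "h = [:- r, 1:] * h'"
        unfolding poly_eq_0_iff_dvd by (rule dvdE)
      then have "h' \<noteq> 0"
        using Suc.prems by auto
      then have "degree h = Suc (degree h')"
        unfolding h by (subst degree_mult_eq) auto
      then have "F h' \<notin> M"
        using Suc.hyps \<open>h' \<noteq> 0\<close> by simp
      then show ?case
        unfolding h F_linear using prime notin by blast
    qed
    have "inj u"
    proof (rule injI, rule ccontr)
      fix c d assume eq: "u c = u d" and "c \<noteq> d"
      have "(u c * (p - cst c) - 1) - (u d * (p - cst d) - 1) \<in> M"
        by (rule ideal.subspace_diff[OF M u u])
      then have "u c * cst (d - c) \<in> M"
        by (simp add: eq single_diff right_diff_distrib)
      then have "u c \<in> M"
        using prime[of "cst (d - c)" "u c"] cst_notin[of "d - c"] \<open>c \<noteq> d\<close> by (simp add: mult.commute)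
      then have "(p - cst c) * u c - (u c * (p - cst c) - 1) \<in> M"
        by (rule ideal.subspace_diff[OF M ideal.subspace_scale[OF M] u])
      then show False
        using proper by (simp add: mult.commute)
    qed
    \<comment> \<open>some space of polynomials of bounded degree contains infinitely many \<open>u c\<close>\<close>
    define V where "V d = cpm.span ((\<lambda>m. Poly_Mapping.single m 1) ` {m :: 'n monom. mdeg m \<le> d})" for d
    have "\<exists>d. q \<in> V d" for q
    proof -
      have "Poly_Mapping.keys q \<subseteq> {m. mdeg m \<le> (\<Sum>m\<in>Poly_Mapping.keys q. mdeg m)}"
        by (auto intro: member_le_sum)
      then show ?thesis
        unfolding V_def using in_span_monomials by blast
    qed
    then have "(\<Union>d. {c. u c \<in> V d}) = UNIV"
      by auto
    then have "\<exists>d. infinite {c. u c \<in> V d}"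
      using uncountable_UNIV_complex countable_UN[of UNIV "\<lambda>d. {c. u c \<in> V d}"] countable_finite by auto
    then obtain d where d: "infinite {c. u c \<in> V d}" by blast
    have "cpm.dependent (u ` {c. u c \<in> V d})"
    proof (rule ccontr)
      assume "\<not> cpm.dependent (u ` {c. u c \<in> V d})"
      then have "finite (u ` {c. u c \<in> V d})"
        using cpm.independent_span_bound[OF finite_imageI[OF finite_mdeg_le]] unfolding V_def by blast
      then show False
        using d \<open>inj u\<close> by (metis finite_imageD inj_on_subset subset_UNIV)
    qed
    then obtain t a where t: "finite t" "t \<subseteq> u ` {c. u c \<in> V d}" "(\<Sum>v\<in>t. cscale (a v) v) = 0"
      "\<exists>v\<in>t. a v \<noteq> 0"
      unfolding cpm.dependent_explicit by blast
    then obtain T where T: "finite T" and tT: "t = u ` T"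
      using finite_subset_image[OF t(1,2)] by blast
    define b where "b c = a (u c)" for c
    obtain c0 where c0: "c0 \<in> T" "b c0 \<noteq> 0"
      using t(4) by (auto simp: tT b_def)
    have rel: "(\<Sum>c\<in>T. cst (b c) * u c) = 0"
      using t(3) \<open>inj u\<close> by (simp add: tT sum.reindex inj_on_subset b_def cscale_conv_mult)
    \<comment> \<open>numerator of the partial fraction \<open>\<Sum>\<^sub>c b c / (X - c)\<close>\<close>
    define h where "h = (\<Sum>c\<in>T. smult (b c) (\<Prod>l\<in>T - {c}. [:- l, 1:]))"
    define Q where "Q = (\<Prod>l\<in>T. p - cst l)"
    define R where "R c = (\<Prod>l\<in>T - {c}. p - cst l)" for c
    have Q: "Q = (p - cst c) * R c" if "c \<in> T" for c
      using T that by (simp add: Q_def R_def prod.remove)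
    have ring_identity: "k * r - k * v * (x * r) = - (k * r) * (v * x - 1)"
      for k r v x :: "('n, complex) mpoly"
      by (simp add: algebra_simps)
    have "F h = (\<Sum>c\<in>T. cst (b c) * R c)"
      using T by (simp add: h_def F_sum F_smult F_prod R_def)
    also have "\<dots> = (\<Sum>c\<in>T. cst (b c) * R c) - (\<Sum>c\<in>T. cst (b c) * u c) * Q"
      by (simp add: rel)
    also have "\<dots> = (\<Sum>c\<in>T. - (cst (b c) * R c) * (u c * (p - cst c) - 1))"
      unfolding sum_distrib_right sum_subtractf[symmetric]
      by (intro sum.cong refl) (simp only: Q ring_identity)
    also have "\<dots> \<in> M"
      by (intro ideal.subspace_sum[OF M] ideal.subspace_scale[OF M] u)
    finally have "h = 0"
      using F_notin by blast
    moreover have "poly h c0 = b c0 * (\<Prod>l\<in>T - {c0}. c0 - l)"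
    proof -
      have "poly h c0 = (\<Sum>c\<in>T. b c * (\<Prod>l\<in>T - {c}. c0 - l))"
        by (simp add: h_def poly_sum poly_prod)
      also have "\<dots> = (\<Sum>c\<in>T. if c = c0 then b c * (\<Prod>l\<in>T - {c}. c0 - l) else 0)"
        using T c0 by (intro sum.cong refl) (auto intro: prod_zero)
      finally show ?thesis
        using T c0 by simp
    qed
    ultimately show False
      using c0 T by simp
  qed
  then have "\<forall>i. \<exists>c. pvar i - cst c \<in> M"
    by blast
  then obtain c where c: "\<And>i. pvar i - cst (c i) \<in> M"
    unfolding choice_iff by blast
  define \<zeta> where "\<zeta> = (\<chi> i. c i)"
  have peval: "p - cst (peval p \<zeta>) \<in> M" for p
  proof (induction p rule: mpoly_induct)
    case (const a)
    then show ?case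
      using ideal.subspace_0[OF M] by simp
  next
    case (var i)
    then show ?case
      using c by (simp add: \<zeta>_def)
  next
    case (add p q)
    then show ?case
      using ideal.subspace_add[OF M] by (fastforce simp: peval_add single_add add_diff_add)
  next
    case (mult p q)
    have "q * (p - cst (peval p \<zeta>)) + cst (peval p \<zeta>) * (q - cst (peval q \<zeta>)) \<in> M"
      by (intro ideal.subspace_add[OF M] ideal.subspace_scale[OF M] mult)
    then show ?case
      by (simp add: peval_mult right_diff_distrib mult.commute flip: cst_mult)
  qed
  show ?thesis
  proof (rule that, rule ccontr)
    fix p assume "p \<in> J" "peval p \<zeta> \<noteq> 0"
    then have "p - (p - cst (peval p \<zeta>)) \<in> M"
      by (intro ideal.subspace_diff[OF M] subsetD[OF JM] peval)
    then show False
      using cst_notin \<open>peval p \<zeta> \<noteq> 0\<close> by simp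
  qed
qed

text \<open>If no power of \<open>x\<^sub>i\<close> is in the homogeneous ideal \<open>I\<close>, then adding \<open>x\<^sub>i - 1\<close> leaves it proper, which gives
  a zero with \<open>i\<close>-th coordinate \<open>1\<close>. Indeed, if \<open>1 - g (x\<^sub>i - 1) \<in> I\<close>, comparing homogeneous parts shows that the
  part of \<open>g\<close> of degree \<open>d\<close> is \<open>- x\<^sub>i\<^sup>d\<close> modulo \<open>I\<close>; it is zero for large \<open>d\<close>.\<close>

lemma projective_nullstellensatz:
  fixes H :: "('n::finite, complex) mpoly set"
  assumes H: "H \<subseteq> Sym_dual e"
    and no_zero: "\<And>\<zeta>. \<forall>f\<in>H. peval f \<zeta> = 0 \<Longrightarrow> \<zeta> = 0"
  shows "\<exists>N. pvar i ^ N \<in> ideal.span H"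
proof (rule ccontr)
  assume not_nilpotent: "\<nexists>N. pvar i ^ N \<in> ideal.span H"
  let ?J = "ideal.span (insert (pvar i - 1) H)"
  have "1 \<notin> ?J"
  proof
    assume "1 \<in> ?J"
    then obtain g where g: "1 - g * (pvar i - 1) \<in> ideal.span H"
      by (auto simp: ideal.span_breakdown_eq)
    have pvar: "pvar i \<in> Sym_dual 1" and one: "(1 :: ('n, complex) mpoly) \<in> Sym_dual 0"
      unfolding pvar_def single_one[symmetric] by (intro Sym_dual_single; simp)+
    have part: "hom_part d (1 - g * (pvar i - 1))
        = (if d = 0 then 1 else 0) - (if 1 \<le> d then hom_part (d - 1) g * pvar i else 0) + hom_part d g" for d
      by (simp add: right_diff_distrib hom_part_diff hom_part_add hom_part_mult[OF pvar] hom_part_Sym_dual[OF one])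
    have "hom_part d g + pvar i ^ d \<in> ideal.span H" for d
    proof (induction d)
      case 0
      show ?case
        using hom_part_ideal(1)[OF H g, of 0] unfolding part by (simp add: add.commute)
    next
      case (Suc d)
      have "(hom_part (Suc d) g - hom_part d g * pvar i) + pvar i * (hom_part d g + pvar i ^ d) \<in> ideal.span H"
        using hom_part_ideal(1)[OF H g, of "Suc d"] unfolding part
        by (intro ideal.span_add[OF _ ideal.span_scale[OF Suc]]) simp
      then show ?case
        by (simp add: distrib_left mult.commute)
    qed
    moreover have "hom_part (Suc (\<Sum>m\<in>Poly_Mapping.keys g. mdeg m)) g = 0"
    proof (rule poly_mapping_eqI)
      fix m
      have "mdeg m \<le> (\<Sum>m\<in>Poly_Mapping.keys g. mdeg m)" if "m \<in> Poly_Mapping.keys g"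
        using that by (intro member_le_sum) auto
      then have "m \<notin> Poly_Mapping.keys g \<or> mdeg m \<noteq> Suc (\<Sum>m\<in>Poly_Mapping.keys g. mdeg m)"
        by fastforce
      then show "lkp (hom_part (Suc (\<Sum>m\<in>Poly_Mapping.keys g. mdeg m)) g) m = lkp 0 m"
        by (auto simp: lookup_hom_part in_keys_iff)
    qed
    ultimately show False
      using not_nilpotent by (metis add_0)
  qed
  then obtain \<zeta> where \<zeta>: "\<And>p. p \<in> ?J \<Longrightarrow> peval p \<zeta> = 0"
    using weak_nullstellensatz[OF ideal.subspace_span] by blast
  then have "\<zeta> = 0"
    using ideal.span_base by (intro no_zero) blast
  moreover have "peval (pvar i - 1) \<zeta> = 0"
    using \<zeta> ideal.span_base by blast
  then have "\<zeta> $ i = 1"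
    by (simp add: peval_diff peval_cst[of 1, simplified])
  ultimately show False
    by simp
qed

section \<open>Constant pivots as common zeros\<close>

lemma peval_sum: "peval (\<Sum>x\<in>S. f x) v = (\<Sum>x\<in>S. peval (f x) v)"
  by (induction S rule: infinite_finite_induct) (simp_all add: peval_add)

text \<open>Monomials are distinct characters of the multiplicative monoid of vectors, so Dedekind's argument
  applies: if two monomials of \<open>p\<close> differ in the exponent of \<open>v\<^sub>i\<close>, scaling \<open>v\<^sub>i\<close> by \<open>2\<close> and subtracting a
  multiple of \<open>p\<close> cancels one of them and keeps the other.\<close>

lemma vanishing_imp_0:
  fixes p :: "('n::finite, complex) mpoly"
  assumes "\<And>v. peval p v = 0"
  shows "p = 0"
  using assms
proof (induction "card (Poly_Mapping.keys p)" arbitrary: p rule: less_induct)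
  case less
  show ?case
  proof (cases "\<exists>m\<in>Poly_Mapping.keys p. \<exists>n\<in>Poly_Mapping.keys p. m \<noteq> n")
    case True
    then obtain m n where m: "m \<in> Poly_Mapping.keys p" and n: "n \<in> Poly_Mapping.keys p" and "m \<noteq> n"
      by blast
    then obtain i where i: "lkp m i \<noteq> lkp n i"
      using poly_mapping_eqI by metis
    define q where "q = Poly_Mapping.mapp (\<lambda>k c. (2 ^ lkp k i - 2 ^ lkp m i) * c) p"
    have lookup_q: "lkp q k = (2 ^ lkp k i - 2 ^ lkp m i) * lkp p k" for k
      by (simp add: q_def lookup_mapp when_def in_keys_iff)
    have keys: "Poly_Mapping.keys q \<subseteq> Poly_Mapping.keys p - {m}"
      by (auto simp: in_keys_iff lookup_q)
    have "peval q v = 0" for v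
    proof -
      define w where "w = (\<chi> j. if j = i then 2 * v $ j else v $ j)"
      have "(\<Prod>j\<in>UNIV. (w $ j) ^ lkp k j) = 2 ^ lkp k i * (\<Prod>j\<in>UNIV. (v $ j) ^ lkp k j)" for k
      proof -
        have "(\<Prod>j\<in>UNIV. (w $ j) ^ lkp k j) = (\<Prod>j\<in>UNIV. (if j = i then 2 ^ lkp k j else 1) * (v $ j) ^ lkp k j)"
          by (intro prod.cong refl) (simp add: w_def power_mult_distrib)
        then show ?thesis
          by (simp add: prod.distrib)
      qed
      moreover have "peval q v = (\<Sum>k\<in>Poly_Mapping.keys p. lkp q k * (\<Prod>j\<in>UNIV. (v $ j) ^ lkp k j))"
        using keys by (intro peval_superset) auto
      ultimately have "peval q v = peval p w - 2 ^ lkp m i * peval p v"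
        by (simp add: peval_def lookup_q sum_distrib_left sum_subtractf[symmetric] left_diff_distrib right_diff_distrib mult_ac)
      then show ?thesis
        using less.prems by simp
    qed
    moreover have "card (Poly_Mapping.keys q) < card (Poly_Mapping.keys p)"
      using keys m by (intro psubset_card_mono) auto
    ultimately have "q = 0"
      by (intro less.hyps)
    then have "(2 ^ lkp n i - 2 ^ lkp m i) * lkp p n = (0 :: complex)"
      using lookup_q[of n] by simp
    moreover have "(2 :: complex) ^ lkp n i \<noteq> 2 ^ lkp m i"
    proof
      assume "(2 :: complex) ^ lkp n i = 2 ^ lkp m i"
      then have "norm ((2 :: complex) ^ lkp n i) = norm ((2 :: complex) ^ lkp m i)"
        by simp
      then show False
        using i by (simp add: norm_power)
    qed
    ultimately show ?thesis
      using n by (simp add: in_keys_iff)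
  next
    case False
    show ?thesis
    proof (rule ccontr)
      assume "p \<noteq> 0"
      then obtain m where "m \<in> Poly_Mapping.keys p"
        by (metis all_not_in_conv keys_eq_empty)
      then have "Poly_Mapping.keys p = {m}"
        using False by blast
      then have "peval p (\<chi> i. 1) = lkp p m"
        by (simp add: peval_def)
      then show False
        using less.prems \<open>m \<in> Poly_Mapping.keys p\<close> by (simp add: in_keys_iff)
    qed
  qed
qed

lemma constant_iff_peval_constant:
  fixes p :: "('n::finite, complex) mpoly"
  shows "(\<exists>k. p = cst k) \<longleftrightarrow> (\<forall>a b. peval p a = peval p b)"
proof
  assume "\<forall>a b. peval p a = peval p b"
  then have "peval (p - cst (peval p 0)) v = 0" for v
    by (simp add: peval_diff)
  then have "p - cst (peval p 0) = 0"
    by (rule vanishing_imp_0)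
  then show "\<exists>k. p = cst k"
    by auto
qed auto

lemma peval_cscale: "peval (cscale c p) v = c * peval p v"
  by (simp add: cscale_conv_mult peval_mult)

lemma subspace_peval_0: "cpm.subspace {p. peval p v = 0}"
  by (rule cpm.subspaceI) (simp_all add: peval_add peval_cscale)

lemma subspace_Sym_dual: "cpm.subspace (Sym_dual d)"
proof (rule cpm.subspaceI)
  show "p + q \<in> Sym_dual d" if "p \<in> Sym_dual d" "q \<in> Sym_dual d" for p q
    using that Poly_Mapping.keys_add[of p q] by (auto simp: Sym_dual_iff)
  show "cscale c p \<in> Sym_dual d" if "p \<in> Sym_dual d" for c p
    using that by (auto simp: Sym_dual_iff in_keys_iff)
qed (simp add: Sym_dual_iff)

lemma complex_constant_pivot_iff:
  "complex_constant_pivot \<phi> \<zeta> \<longleftrightarrow> \<zeta> \<noteq> 0 \<and> (\<forall>q\<in>hesse_system \<phi>. peval q \<zeta> = 0)"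
proof -
  define P where "P = (\<Sum>i\<in>UNIV. \<Sum>j\<in>UNIV.
             pderiv_at i (pderiv_at j (complexify \<phi>)) * cst (\<zeta> $ i * \<zeta> $ j))"
  have hess: "peval (hessian_form \<phi> c) \<zeta> = peval P c" for c
    by (simp add: hessian_form_def P_def peval_sum peval_cscale peval_mult)
  have "(\<forall>q\<in>hesse_system \<phi>. peval q \<zeta> = 0) \<longleftrightarrow> hesse_system \<phi> \<subseteq> {q. peval q \<zeta> = 0}"
    by blast
  also have "\<dots> \<longleftrightarrow> {hessian_form \<phi> a - hessian_form \<phi> b | a b. True} \<subseteq> {q. peval q \<zeta> = 0}"
    unfolding hesse_system_def
    by (rule iffI) (erule order.trans[OF cpm.span_superset], erule cpm.span_minimal[OF _ subspace_peval_0])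
  also have "\<dots> \<longleftrightarrow> (\<forall>a b. peval P a = peval P b)"
  proof -
    have "{hessian_form \<phi> a - hessian_form \<phi> b | a b. True} \<subseteq> S
        \<longleftrightarrow> (\<forall>a b. hessian_form \<phi> a - hessian_form \<phi> b \<in> S)" for S
      by blast
    then show ?thesis
      by (simp add: peval_diff hess)
  qed
  finally show ?thesis
    unfolding complex_constant_pivot_def P_def[symmetric] constant_iff_peval_constant by simp
qed

lemma hesse_system_subset: "hesse_system \<phi> \<subseteq> Sym_dual 2"
proof -
  have "pvar i * pvar j \<in> Sym_dual 2" for i j :: 'a
    using Sym_dual_mult[of "pvar i" 1 "pvar j" 1] by (simp add: pvar_def Sym_dual_single numeral_2_eq_2)
  then have "hessian_form \<phi> c \<in> Sym_dual 2" for c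
    unfolding hessian_form_def
    by (intro cpm.subspace_sum[OF subspace_Sym_dual] cpm.subspace_scale[OF subspace_Sym_dual])
  then show ?thesis
    unfolding hesse_system_def
    by (intro cpm.span_minimal subspace_Sym_dual) (auto intro: cpm.subspace_diff[OF subspace_Sym_dual])
qed

section \<open>Dimensions\<close>

lemma mult_map_tensor_space: "mult_map ` tensor_space (Sym_dual k) H = products k H"
proof -
  interpret Vector_Spaces.linear cscale cscale mult_map
    by (rule linear_mult_map)
  show ?thesis
    unfolding tensor_space_def products_def span_image[symmetric]
    by (intro arg_cong[of _ _ cpm.span]) (force simp: mult_map_tensor)
qed

lemma products_subset: "H \<subseteq> Sym_dual e \<Longrightarrow> products k H \<subseteq> Sym_dual (k + e)"
  unfolding products_def
  by (intro cpm.span_minimal subspace_Sym_dual) (auto intro: Sym_dual_mult)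

text \<open>An enumeration of the variables turns exponent vectors into lists with prescribed sum.\<close>

lemma card_mdeg_eq: "card {m :: 'n::finite monom. mdeg m = d} = (d + CARD('n) - 1) choose d"
proof -
  obtain h where h: "bij_betw h {0..<CARD('n)} (UNIV :: 'n set)"
    using ex_bij_betw_nat_finite[of "UNIV :: 'n set"] by auto
  define f where "f m = map (\<lambda>k. lkp m (h k)) [0..<CARD('n)]" for m :: "'n monom"
  have "bij_betw f {m. mdeg m = d} {l. length l = CARD('n) \<and> sum_list l = d}"
  proof (rule bij_betwI')
    fix m n :: "'n monom"
    show "f m = f n \<longleftrightarrow> m = n"
    proof
      assume eq: "f m = f n"
      have "lkp m i = lkp n i" for i
      proof -
        obtain k where "k \<in> {0..<CARD('n)}" "i = h k"
          using h by (metis UNIV_I bij_betw_imp_surj_on imageE)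
        then show ?thesis
          using eq by (auto simp: f_def)
      qed
      then show "m = n"
        by (rule poly_mapping_eqI)
    qed simp
  next
    fix m :: "'n monom" assume "m \<in> {m. mdeg m = d}"
    moreover have "sum_list (f m) = mdeg m"
      by (simp add: f_def mdeg_def sum_list_distinct_conv_sum_set sum.reindex_bij_betw[OF h])
    ultimately show "f m \<in> {l. length l = CARD('n) \<and> sum_list l = d}"
      by (simp add: f_def)
  next
    fix l :: "nat list" assume l: "l \<in> {l. length l = CARD('n) \<and> sum_list l = d}"
    define m where "m = (\<Sum>i\<in>UNIV. Poly_Mapping.single i (l ! inv_into {0..<CARD('n)} h i))"
    have lookup_m: "lkp m (h k) = l ! k" if "k < CARD('n)" for k
      using that h by (simp add: m_def lookup_sum lookup_single when_def bij_betw_inv_into_left[OF h])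
    have fm: "f m = l"
      using l by (intro nth_equalityI) (simp_all add: f_def lookup_m)
    have "mdeg m = (\<Sum>k\<in>{0..<CARD('n)}. lkp m (h k))"
      unfolding mdeg_def by (rule sum.reindex_bij_betw[OF h, symmetric])
    also have "\<dots> = sum_list (f m)"
      by (simp add: f_def sum_list_distinct_conv_sum_set)
    finally have "mdeg m = d"
      using fm l by simp
    then show "\<exists>m\<in>{m. mdeg m = d}. l = f m"
      using fm by auto
  qed
  then show ?thesis
    by (simp add: bij_betw_same_card card_length_sum_list)
qed

lemma Sym_dual_eq_span: "Sym_dual d = cpm.span ((\<lambda>m. Poly_Mapping.single m 1) ` {m. mdeg m = d})"
proof
  show "Sym_dual d \<subseteq> cpm.span ((\<lambda>m. Poly_Mapping.single m 1) ` {m. mdeg m = d})"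
    by (auto simp: Sym_dual_iff intro: in_span_monomials)
  show "cpm.span ((\<lambda>m. Poly_Mapping.single m 1) ` {m. mdeg m = d}) \<subseteq> Sym_dual d"
    by (intro cpm.span_minimal subspace_Sym_dual) (auto intro: Sym_dual_single)
qed

lemma finite_mdeg_eq: "finite {m :: 'n::finite monom. mdeg m = d}"
  by (rule finite_subset[OF _ finite_mdeg_le[of d]]) auto

lemma inj_single_1: "inj_on (\<lambda>m. Poly_Mapping.single m (1::complex)) S"
  by (rule inj_onI) (metis keys_single singleton_inject zero_neq_one)

lemma independent_monomials:
  "cpm.independent ((\<lambda>m. Poly_Mapping.single m 1) ` S)"
proof
  assume "cpm.dependent ((\<lambda>m. Poly_Mapping.single m 1) ` S)"
  then obtain t u where t: "finite t" "t \<subseteq> (\<lambda>m. Poly_Mapping.single m 1) ` S"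
    and zero: "(\<Sum>v\<in>t. cscale (u v) v) = 0" and "\<exists>v\<in>t. u v \<noteq> 0"
    unfolding cpm.dependent_explicit by blast
  then obtain m where m: "Poly_Mapping.single m 1 \<in> t" "u (Poly_Mapping.single m 1) \<noteq> 0"
    by blast
  have "lkp (\<Sum>v\<in>t. cscale (u v) v) m = (\<Sum>v\<in>t. if v = Poly_Mapping.single m 1 then u v else 0)"
    unfolding lookup_sum
  proof (rule sum.cong[OF refl])
    fix v assume "v \<in> t"
    then obtain n where "v = Poly_Mapping.single n 1"
      using t by blast
    then show "lkp (cscale (u v) v) m = (if v = Poly_Mapping.single m 1 then u v else 0)"
      using inj_single_1[of UNIV] by (auto simp: lookup_single when_def dest: injD)
  qed
  then show False
    using zero m t by simp
qed

lemma dim_Sym_dual: "cpm.dim (Sym_dual d :: ('n::finite, complex) mpoly set) = (d + CARD('n) - 1) choose d"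
  unfolding Sym_dual_eq_span cpm.dim_span_eq_card_independent[OF independent_monomials]
  by (simp add: card_image inj_single_1 card_mdeg_eq)

lemma dim_subspace_less:
  assumes W: "cpm.subspace W" and U: "W \<subset> cpm.span B" and B: "finite B"
  shows "cpm.dim W < card B"
proof -
  obtain C where C: "C \<subseteq> W" "cpm.independent C" "W \<subseteq> cpm.span C" "card C = cpm.dim W"
    by (rule cpm.basis_exists)
  obtain x where x: "x \<in> cpm.span B" "x \<notin> W"
    using U by blast
  have "cpm.span C = W"
    using C W by (metis cpm.span_subspace)
  then have "cpm.independent (insert x C)"
    using C x by (intro cpm.independent_insertI) auto
  then have fin: "finite (insert x C) \<and> card (insert x C) \<le> card B"
    using C U x by (intro cpm.independent_span_bound[OF B]) auto
  have "x \<notin> C"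
    using C x by blast
  then have "card (insert x C) = Suc (card C)"
    using fin by simp
  then show ?thesis
    using fin C by simp
qed

theorem proposition4p3:
  fixes \<phi> :: "(4, real) mpoly"
  shows "(\<exists>\<zeta>. complex_constant_pivot \<phi> \<zeta>) \<longleftrightarrow> rank_mu \<phi> \<le> 55"
proof -
  let ?H = "hesse_system \<phi>"
  let ?W = "products 3 ?H"
  let ?S = "Sym_dual 5 :: (4, complex) mpoly set"
  have H: "?H \<subseteq> Sym_dual 2"
    by (rule hesse_system_subset)
  have sub: "?W \<subseteq> ?S"
    using products_subset[OF H, of 3] by simp
  have rank: "rank_mu \<phi> = cpm.dim ?W"
    by (simp add: rank_mu_def rank_on_def mult_map_tensor_space)
  have "((8::nat) choose 5) = 56"
    by (simp add: binomial_fact' fact_numeral)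
  then have dim_S: "cpm.dim ?S = 56"
    by (simp add: dim_Sym_dual)
  show ?thesis
  proof
    assume "\<exists>\<zeta>. complex_constant_pivot \<phi> \<zeta>"
    then obtain \<zeta> where "\<zeta> \<noteq> 0" and zero: "\<And>q. q \<in> ?H \<Longrightarrow> peval q \<zeta> = 0"
      by (auto simp: complex_constant_pivot_iff)
    then obtain i where i: "\<zeta> $ i \<noteq> 0"
      by (auto simp: vec_eq_iff)
    have "?W \<subseteq> {p. peval p \<zeta> = 0}"
      unfolding products_def
      by (intro cpm.span_minimal subspace_peval_0) (auto simp: peval_mult zero)
    moreover have "peval (Poly_Mapping.single (Poly_Mapping.single i 5) 1) \<zeta> \<noteq> 0"
      using i by (auto simp: peval_single lookup_single when_def)
    moreover have "Poly_Mapping.single (Poly_Mapping.single i 5) 1 \<in> ?S"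
      by (rule Sym_dual_single) simp
    ultimately have "?W \<subset> ?S"
      using sub by blast
    then have "cpm.dim ?W < card ((\<lambda>m. Poly_Mapping.single m (1::complex)) ` {m :: 4 monom. mdeg m = 5})"
      unfolding Sym_dual_eq_span
      by (intro dim_subspace_less finite_imageI finite_mdeg_eq) (auto simp: products_def)
    also have "\<dots> = cpm.dim ?S"
      unfolding Sym_dual_eq_span by (rule cpm.dim_span_eq_card_independent[OF independent_monomials, symmetric])
    finally show "rank_mu \<phi> \<le> 55"
      by (simp add: rank dim_S)
  next
    assume small: "rank_mu \<phi> \<le> 55"
    show "\<exists>\<zeta>. complex_constant_pivot \<phi> \<zeta>"
    proof (rule ccontr)
      assume "\<nexists>\<zeta>. complex_constant_pivot \<phi> \<zeta>"
      then have "\<exists>N. pvar i ^ N \<in> ideal.span ?H" for i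
        by (intro projective_nullstellensatz[OF H]) (auto simp: complex_constant_pivot_iff)
      then have "?S \<subseteq> ?W"
        using nilpotent_imp_all_forms[OF H, of _ 3] by auto
      then have "?W = ?S"
        using sub by blast
      then show False
        using small by (simp add: rank dim_S)
    qed
  qed
qed

end
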